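(* Let $G$ be a Gromov-hyperbolic group with Cayley graph $\Gamma=\Gamma(G,S)$, and let $\rho$ satisfy (i)–(iii) of the context. For every vertex $o\in\Gamma$, for $\mathbb{P}$-a.e. $\omega\in\Omega$, every $\omega$-geodesic ray starting at $o$ has a direction $\xi\in\partial G$.
   Context: $G$ is a finitely generated (Gromov-)hyperbolic group, $S$ a finite symmetric generating set, $\Gamma=\Gamma(G,S)$ the undirected Cayley graph (vertex set $G$; an edge between $g$ and $h$ iff $g^{-1}h\in S$) with edge set $E$, and $\partial G$ is the Gromov boundary. First passage percolation: $\rho$ is a probability measure such that (i) its support is contained in $[0,\infty)$; (ii) it has no atoms; (iii) $\int e^{ax^2}\,d\rho(x)<\infty$ for some $a>0$. $\Omega=[0,\infty)^E$ carries $\mathbb{P}=\rho^{\otimes E}$. For an edge path $\gamma$, $\ell_\omega(\gamma)=\sum_{e\in\gamma}\omega(e)$, and $d_\omega(x,y)=\inf_\gamma\ell_\omega(\gamma)$ over edge paths from $x$ to $y$. An $\omega$-geodesic between $x$ and $y$ is a path attaining $d_\omega(x,y)$ (for a.e. $\omega$ it exists and is unique for every pair $x,y$). An $\omega$-geodesic ray is a semi-infinite path all of whose finite subpaths are $\omega$-geodesics. A path $\sigma$ accumulates on $\xi\in\partial G$ if there are $v_n\in\sigma$ with $v_n\to\xi$ in the Gromov compactification $\Gamma\cup\partial G$. An $\omega$-geodesic ray has direction $\xi$ if $\xi$ is an accumulation point of it in $\partial G$ and is its only accumulation point in $\partial G$. *)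

theory Defs
  imports "HOL-Probability.Probability" "HOL-Algebra.Generated_Groups"
begin

section \<open>Paths and passage times in an undirected graph\<close>

text \<open>
  A graph is given by its vertex set \<open>V\<close> and its set \<open>E\<close> of undirected edges \<open>{x, y}\<close>; a singleton
  \<open>{x}\<close> in \<open>E\<close> is a loop. There are no multiple edges, so an edge path is determined by
  the nonempty list of the vertices it visits.
\<close>

definition edge_path :: "'a set \<Rightarrow> 'a set set \<Rightarrow> 'a list \<Rightarrow> bool" where
  "edge_path V E p \<longleftrightarrow> p \<noteq> [] \<and> set p \<subseteq> V \<and> successively (\<lambda>x y. {x, y} \<in> E) p"

definition path_length :: "('a set \<Rightarrow> real) \<Rightarrow> 'a list \<Rightarrow> real" where
  "path_length \<omega> p = (\<Sum>i<length p - 1. \<omega> {p ! i, p ! Suc i})"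

definition fpp_dist :: "'a set \<Rightarrow> 'a set set \<Rightarrow> ('a set \<Rightarrow> real) \<Rightarrow> 'a \<Rightarrow> 'a \<Rightarrow> real" where
  "fpp_dist V E \<omega> x y = (INF p \<in> {p. edge_path V E p \<and> hd p = x \<and> last p = y}. path_length \<omega> p)"

definition fpp_geodesic :: "'a set \<Rightarrow> 'a set set \<Rightarrow> ('a set \<Rightarrow> real) \<Rightarrow> 'a list \<Rightarrow> bool" where
  "fpp_geodesic V E \<omega> p \<longleftrightarrow>
     edge_path V E p \<and> path_length \<omega> p = fpp_dist V E \<omega> (hd p) (last p)"

definition fpp_geodesic_ray :: "'a set \<Rightarrow> 'a set set \<Rightarrow> ('a set \<Rightarrow> real) \<Rightarrow> (nat \<Rightarrow> 'a) \<Rightarrow> bool" where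
  "fpp_geodesic_ray V E \<omega> \<sigma> \<longleftrightarrow> (\<forall>m n. m \<le> n \<longrightarrow> fpp_geodesic V E \<omega> (map \<sigma> [m..<Suc n]))"

text \<open>The graph distance is the passage time for unit weights.\<close>

definition graph_dist :: "'a set \<Rightarrow> 'a set set \<Rightarrow> 'a \<Rightarrow> 'a \<Rightarrow> real" where
  "graph_dist V E = fpp_dist V E (\<lambda>_. 1)"


section \<open>Hyperbolicity, Gromov boundary and Gromov compactification\<close>

definition gromov_product :: "('a \<Rightarrow> 'a \<Rightarrow> real) \<Rightarrow> 'a \<Rightarrow> 'a \<Rightarrow> 'a \<Rightarrow> real" where
  "gromov_product d w x y = (d x w + d y w - d x y) / 2"

definition gromov_hyperbolic :: "'a set \<Rightarrow> ('a \<Rightarrow> 'a \<Rightarrow> real) \<Rightarrow> bool" where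
  "gromov_hyperbolic V d \<longleftrightarrow>
     (\<exists>\<delta>. \<forall>w\<in>V. \<forall>x\<in>V. \<forall>y\<in>V. \<forall>z\<in>V.
        gromov_product d w x z \<ge> min (gromov_product d w x y) (gromov_product d w y z) - \<delta>)"

text \<open>
  The boundary of \<open>(V, d)\<close> consists of the equivalence classes of sequences converging at infinity,
  \<open>x\<close> and \<open>y\<close> being equivalent if \<open>(x\<^sub>i | y\<^sub>j)\<close> tends to infinity as \<open>i, j\<close> do.
  Gromov products are taken at the base point \<open>w\<close>; changing it changes them by a bounded amount.
\<close>

definition gromov_equiv :: "('a \<Rightarrow> 'a \<Rightarrow> real) \<Rightarrow> 'a \<Rightarrow> (nat \<Rightarrow> 'a) \<Rightarrow> (nat \<Rightarrow> 'a) \<Rightarrow> bool" where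
  "gromov_equiv d w x y \<longleftrightarrow>
     filterlim (\<lambda>(i, j). gromov_product d w (x i) (y j)) at_top (sequentially \<times>\<^sub>F sequentially)"

definition converging_at_infinity :: "'a set \<Rightarrow> ('a \<Rightarrow> 'a \<Rightarrow> real) \<Rightarrow> 'a \<Rightarrow> (nat \<Rightarrow> 'a) set" where
  "converging_at_infinity V d w = {x. range x \<subseteq> V \<and> gromov_equiv d w x x}"

definition gromov_boundary :: "'a set \<Rightarrow> ('a \<Rightarrow> 'a \<Rightarrow> real) \<Rightarrow> 'a \<Rightarrow> (nat \<Rightarrow> 'a) set set" where
  "gromov_boundary V d w =
     converging_at_infinity V d w //
       {(x, y). x \<in> converging_at_infinity V d w \<and> y \<in> converging_at_infinity V d w \<and>
                gromov_equiv d w x y}"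

text \<open>
  The compactification lives on the disjoint union of \<open>V\<close> (embedded by \<^const>\<open>Inl\<close>) and the boundary
  (embedded by \<^const>\<open>Inr\<close>). The basic neighbourhood of \<open>\<xi>\<close> of level \<open>r\<close> consists of the points
  \<open>\<zeta>\<close> such that, for some sequences representing \<open>\<xi>\<close> and \<open>\<zeta>\<close> (the constant sequence, if
  \<open>\<zeta>\<close> is a vertex), the limes inferior of the Gromov products is at least \<open>r\<close>. In a graph these
  products are half-integers, so this says that they are eventually at least \<open>r\<close>.
\<close>

definition gromov_nhd ::
    "'a set \<Rightarrow> ('a \<Rightarrow> 'a \<Rightarrow> real) \<Rightarrow> 'a \<Rightarrow> (nat \<Rightarrow> 'a) set \<Rightarrow> real \<Rightarrow> ('a + (nat \<Rightarrow> 'a) set) set" where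
  "gromov_nhd V d w \<xi> r =
     Inl ` {v \<in> V. \<exists>x\<in>\<xi>. \<forall>\<^sub>F i in sequentially. r \<le> gromov_product d w (x i) v} \<union>
     Inr ` {\<eta> \<in> gromov_boundary V d w. \<exists>x\<in>\<xi>. \<exists>y\<in>\<eta>.
              \<forall>\<^sub>F (i, j) in sequentially \<times>\<^sub>F sequentially. r \<le> gromov_product d w (x i) (y j)}"

text \<open>Vertices are isolated points of the compactification.\<close>

definition gromov_compactification ::
    "'a set \<Rightarrow> ('a \<Rightarrow> 'a \<Rightarrow> real) \<Rightarrow> 'a \<Rightarrow> ('a + (nat \<Rightarrow> 'a) set) topology" where
  "gromov_compactification V d w = topology (\<lambda>W.
     W \<subseteq> Inl ` V \<union> Inr ` gromov_boundary V d w \<and>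
     (\<forall>\<xi>. Inr \<xi> \<in> W \<longrightarrow> (\<exists>r. gromov_nhd V d w \<xi> r \<subseteq> W)))"

lemma gromov_nhd_antimono:
  assumes "r \<le> s" shows "gromov_nhd V d w \<xi> s \<subseteq> gromov_nhd V d w \<xi> r"
proof -
  have "\<forall>\<^sub>F i in sequentially. r \<le> gromov_product d w (x i) v"
    if "\<forall>\<^sub>F i in sequentially. s \<le> gromov_product d w (x i) v" for x v
    using that by (rule eventually_mono) (use assms in auto)
  moreover have "\<forall>\<^sub>F (i, j) in sequentially \<times>\<^sub>F sequentially. r \<le> gromov_product d w (x i) (y j)"
    if "\<forall>\<^sub>F (i, j) in sequentially \<times>\<^sub>F sequentially. s \<le> gromov_product d w (x i) (y j)" for x y
    using that by (rule eventually_mono) (use assms in auto)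
  ultimately show ?thesis
    unfolding gromov_nhd_def by (intro Un_mono image_mono) blast+
qed

lemma openin_gromov_compactification:
  "openin (gromov_compactification V d w) W \<longleftrightarrow>
     W \<subseteq> Inl ` V \<union> Inr ` gromov_boundary V d w \<and>
     (\<forall>\<xi>. Inr \<xi> \<in> W \<longrightarrow> (\<exists>r. gromov_nhd V d w \<xi> r \<subseteq> W))"
proof -
  have inter: "\<exists>t. gromov_nhd V d w \<xi> t \<subseteq> A \<inter> B"
    if "gromov_nhd V d w \<xi> r \<subseteq> A" "gromov_nhd V d w \<xi> s \<subseteq> B" for \<xi> r s A B
    using that gromov_nhd_antimono[of r "max r s" V d w \<xi>] gromov_nhd_antimono[of s "max r s" V d w \<xi>]
    by (intro exI[of _ "max r s"]) auto
  have "istopology (\<lambda>W. W \<subseteq> Inl ` V \<union> Inr ` gromov_boundary V d w \<and>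
      (\<forall>\<xi>. Inr \<xi> \<in> W \<longrightarrow> (\<exists>r. gromov_nhd V d w \<xi> r \<subseteq> W)))"
    unfolding istopology_def
  proof (intro conjI allI impI; (elim conjE)?)
    fix A B :: "('a + (nat \<Rightarrow> 'a) set) set" and \<xi>
    assume "\<forall>\<xi>. Inr \<xi> \<in> A \<longrightarrow> (\<exists>r. gromov_nhd V d w \<xi> r \<subseteq> A)"
      and "\<forall>\<xi>. Inr \<xi> \<in> B \<longrightarrow> (\<exists>r. gromov_nhd V d w \<xi> r \<subseteq> B)" and "Inr \<xi> \<in> A \<inter> B"
    then show "\<exists>r. gromov_nhd V d w \<xi> r \<subseteq> A \<inter> B"
      using inter by (metis IntD1 IntD2)
  next
    fix \<W> :: "('a + (nat \<Rightarrow> 'a) set) set set" and \<xi>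
    assume "\<forall>W\<in>\<W>. W \<subseteq> Inl ` V \<union> Inr ` gromov_boundary V d w \<and>
        (\<forall>\<xi>. Inr \<xi> \<in> W \<longrightarrow> (\<exists>r. gromov_nhd V d w \<xi> r \<subseteq> W))"
      and "Inr \<xi> \<in> \<Union>\<W>"
    then show "\<exists>r. gromov_nhd V d w \<xi> r \<subseteq> \<Union>\<W>"
      by (meson Union_iff Union_upper subset_trans)
  qed blast+
  then show ?thesis
    unfolding gromov_compactification_def by (simp add: topology_inverse')
qed

lemma topspace_gromov_compactification:
  "topspace (gromov_compactification V d w) = Inl ` V \<union> Inr ` gromov_boundary V d w"
proof -
  have "gromov_nhd V d w \<xi> r \<subseteq> Inl ` V \<union> Inr ` gromov_boundary V d w" for \<xi> r
    unfolding gromov_nhd_def by blast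
  then have "openin (gromov_compactification V d w) (Inl ` V \<union> Inr ` gromov_boundary V d w)"
    by (simp add: openin_gromov_compactification)
  then show ?thesis
    by (meson openin_gromov_compactification openin_subset openin_topspace subset_antisym)
qed

definition accumulates_on ::
    "'a set \<Rightarrow> ('a \<Rightarrow> 'a \<Rightarrow> real) \<Rightarrow> 'a \<Rightarrow> (nat \<Rightarrow> 'a) \<Rightarrow> (nat \<Rightarrow> 'a) set \<Rightarrow> bool" where
  "accumulates_on V d w \<sigma> \<xi> \<longleftrightarrow>
     (\<exists>v. range v \<subseteq> range \<sigma> \<and>
          limitin (gromov_compactification V d w) (\<lambda>n::nat. Inl (v n)) (Inr \<xi>) sequentially)"

definition has_direction ::
    "'a set \<Rightarrow> ('a \<Rightarrow> 'a \<Rightarrow> real) \<Rightarrow> 'a \<Rightarrow> (nat \<Rightarrow> 'a) \<Rightarrow> (nat \<Rightarrow> 'a) set \<Rightarrow> bool" where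
  "has_direction V d w \<sigma> \<xi> \<longleftrightarrow>
     accumulates_on V d w \<sigma> \<xi> \<and>
     (\<forall>\<eta>\<in>gromov_boundary V d w. accumulates_on V d w \<sigma> \<eta> \<longrightarrow> \<eta> = \<xi>)"


section \<open>Cayley graphs and hyperbolic groups\<close>

definition finite_symmetric_generating_set :: "('a, 'b) monoid_scheme \<Rightarrow> 'a set \<Rightarrow> bool" where
  "finite_symmetric_generating_set G S \<longleftrightarrow>
     finite S \<and> S \<subseteq> carrier G \<and> (\<forall>s\<in>S. inv\<^bsub>G\<^esub> s \<in> S) \<and> generate G S = carrier G"

definition cayley_edges :: "('a, 'b) monoid_scheme \<Rightarrow> 'a set \<Rightarrow> 'a set set" where
  "cayley_edges G S = {{g, h} | g h. g \<in> carrier G \<and> h \<in> carrier G \<and> inv\<^bsub>G\<^esub> g \<otimes>\<^bsub>G\<^esub> h \<in> S}"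

definition cayley_dist :: "('a, 'b) monoid_scheme \<Rightarrow> 'a set \<Rightarrow> 'a \<Rightarrow> 'a \<Rightarrow> real" where
  "cayley_dist G S = graph_dist (carrier G) (cayley_edges G S)"

text \<open>
  The generating set witnessing hyperbolicity need not be the one whose Cayley graph carries the
  percolation.
\<close>

definition hyperbolic_group :: "('a, 'b) monoid_scheme \<Rightarrow> bool" where
  "hyperbolic_group G \<longleftrightarrow>
     group G \<and>
     (\<exists>T. finite_symmetric_generating_set G T \<and> gromov_hyperbolic (carrier G) (cayley_dist G T))"


section \<open>The probability space\<close>

definition measure_support :: "'a::topological_space measure \<Rightarrow> 'a set" where
  "measure_support M = {x. \<forall>U. open U \<and> x \<in> U \<longrightarrow> emeasure M U > 0}"

definition passage_time_law :: "real measure \<Rightarrow> bool" where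
  "passage_time_law \<rho> \<longleftrightarrow>
     prob_space \<rho> \<and> sets \<rho> = sets borel \<and>
     measure_support \<rho> \<subseteq> {0..} \<and>
     (\<forall>x. emeasure \<rho> {x} = 0) \<and>
     (\<exists>a>0. (\<integral>\<^sup>+ x. ennreal (exp (a * x\<^sup>2)) \<partial>\<rho>) < \<infinity>)"

text \<open>The factors are restricted to \<open>[0, \<infinity>)\<close>, so that the underlying set is \<open>[0, \<infinity>)\<^sup>E\<close>.\<close>

definition passage_time_space :: "'e set \<Rightarrow> real measure \<Rightarrow> ('e \<Rightarrow> real) measure" where
  "passage_time_space E \<rho> = (\<Pi>\<^sub>M e\<in>E. restrict_space \<rho> {0..})"

end

theory Submission
  imports Defs
begin

text \<open>
  Let \<open>\<sigma>\<close> be a geodesic ray of the random metric. In a hyperbolic space, a sequence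
  \<open>\<sigma>\<close> with bounded steps converges to a point of the Gromov boundary as soon as its distance
  from the base point grows fast enough, and very little is needed: a chain of \<open>n\<close> steps loses
  only about \<open>\<delta> log n\<close> in the hyperbolicity inequality for Gromov products. In terms of the
  visual quasi-metric \<open>exp (- \<epsilon> (x | y))\<close>, the chain inequality \<open>visual_chain\<close>
  bounds the distance between the ends of a chain by twice the sum of its steps, so it suffices
  that \<open>exp (- \<epsilon> d(w, \<sigma> i))\<close> is summable. This holds if \<open>\<sigma>\<close> needs at most
  polynomial time to reach a given distance (\<open>converges_if_escapes\<close>), even though geodesics
  of the random metric need not be quasi-geodesics of the word metric.

  This escape rate follows from two crude first moment estimates for paths that start at the given
  vertex \<open>x\<close> and have \<open>n\<close> edges; the number of such paths is at most exponential in
  \<open>n\<close>. The law of the weights has no atom at \<open>0\<close>, so that self-avoiding paths have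
  a passage time at least linear in \<open>n\<close>, up to an additive constant
  (\<open>AE_self_avoiding_paths_long\<close>). The law has a Gaussian moment, so that the weight of the last
  edge is almost surely at most linear in \<open>n\<close> (\<open>AE_last_edge_short\<close>), and summing along a
  shortest path bounds the passage time from \<open>x\<close> to \<open>y\<close> by a quadratic function of the
  graph distance. As the ray is self-avoiding and geodesic, both estimates apply to its initial
  pieces: \<open>n\<close> is at most quadratic in the graph distance between \<open>x\<close> and \<open>\<sigma> n\<close>
  (\<open>AE_geodesic_rays_escape\<close>).

  Hyperbolicity of the group may be witnessed by another generating set than the one of the
  percolation. The word metrics are bi-Lipschitz equivalent, and hyperbolicity is passed on by
  the stability of quasi-geodesics (\<open>quasi_geodesic_product_le\<close>), which is again derived from the
  chain inequality.
\<close>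

section \<open>Chains in hyperbolic spaces\<close>

locale pseudometric_on =
  fixes V :: "'a set" and d :: "'a \<Rightarrow> 'a \<Rightarrow> real"
  assumes dist_self: "x \<in> V \<Longrightarrow> d x x = 0"
    and dist_sym: "x \<in> V \<Longrightarrow> y \<in> V \<Longrightarrow> d x y = d y x"
    and dist_triangle: "x \<in> V \<Longrightarrow> y \<in> V \<Longrightarrow> z \<in> V \<Longrightarrow> d x z \<le> d x y + d y z"
begin

lemma dist_nonneg: "x \<in> V \<Longrightarrow> y \<in> V \<Longrightarrow> 0 \<le> d x y"
  using dist_self[of x] dist_sym[of x y] dist_triangle[of x y x] by simp

lemma product_sym: "x \<in> V \<Longrightarrow> y \<in> V \<Longrightarrow> gromov_product d w x y = gromov_product d w y x"
  using dist_sym[of x y] by (simp add: gromov_product_def)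

lemma product_self: "x \<in> V \<Longrightarrow> gromov_product d w x x = d x w"
  using dist_self[of x] by (simp add: gromov_product_def)

lemma product_nonneg: "w \<in> V \<Longrightarrow> x \<in> V \<Longrightarrow> y \<in> V \<Longrightarrow> 0 \<le> gromov_product d w x y"
  using dist_triangle[of x w y] dist_sym[of w y] by (simp add: gromov_product_def)

lemma product_le: "w \<in> V \<Longrightarrow> x \<in> V \<Longrightarrow> y \<in> V \<Longrightarrow> gromov_product d w x y \<le> d x w"
  using dist_triangle[of y x w] dist_sym[of x y] by (simp add: gromov_product_def)

lemma product_ge: "w \<in> V \<Longrightarrow> x \<in> V \<Longrightarrow> y \<in> V \<Longrightarrow> d x w - d x y \<le> gromov_product d w x y"
  using dist_triangle[of x y w] by (simp add: gromov_product_def)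

lemma product_change_base:
  assumes "w \<in> V" "w' \<in> V" "x \<in> V" "y \<in> V"
  shows "gromov_product d w x y \<le> gromov_product d w' x y + d w' w"
  using assms dist_triangle[of x w' w] dist_triangle[of y w' w]
  by (simp add: gromov_product_def field_simps)

end

locale hyperbolic_space = pseudometric_on V d for V :: "'a set" and d +
  fixes \<delta> :: real
  assumes \<delta>_pos: "0 < \<delta>"
    and hyperbolicity: "w \<in> V \<Longrightarrow> x \<in> V \<Longrightarrow> y \<in> V \<Longrightarrow> z \<in> V \<Longrightarrow>
      min (gromov_product d w x y) (gromov_product d w y z) - \<delta> \<le> gromov_product d w x z"
begin

text \<open>
  The rate is chosen such that the loss of \<open>\<delta>\<close> in the hyperbolicity inequality becomes a factor
  \<open>\<surd>2\<close>; this is the largest factor for which the metrization argument of Frink works.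
\<close>

definition rate :: real where "rate = ln 2 / (2 * \<delta>)"

definition visual :: "'a \<Rightarrow> 'a \<Rightarrow> 'a \<Rightarrow> real" where
  "visual w x y = exp (- (rate * gromov_product d w x y))"

lemma rate_pos: "0 < rate"
  using \<delta>_pos by (simp add: rate_def)

lemma visual_pos: "0 < visual w x y"
  by (simp add: visual_def)

lemma visual_le_iff: "visual w x y \<le> exp (- (rate * c)) \<longleftrightarrow> c \<le> gromov_product d w x y"
  using rate_pos by (simp add: visual_def)

lemma visual_ultrametric:
  assumes "w \<in> V" "x \<in> V" "y \<in> V" "z \<in> V"
  shows "visual w x z \<le> sqrt 2 * max (visual w x y) (visual w y z)"
proof -
  have "sqrt 2 = exp (rate * \<delta>)"
  proof -
    have "exp (rate * \<delta>) ^ 2 = exp (2 * (rate * \<delta>))"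
      by (simp add: power2_eq_square flip: exp_add)
    also have "\<dots> = 2"
      using \<delta>_pos by (simp add: rate_def)
    finally show ?thesis
      by (intro real_sqrt_unique) auto
  qed
  moreover have "max (visual w x y) (visual w y z)
      = exp (- (rate * min (gromov_product d w x y) (gromov_product d w y z)))"
    using rate_pos by (auto simp: visual_def max_def min_def)
  ultimately have "sqrt 2 * max (visual w x y) (visual w y z)
      = exp (- (rate * (min (gromov_product d w x y) (gromov_product d w y z) - \<delta>)))"
    by (simp add: algebra_simps flip: exp_add)
  then show ?thesis
    using hyperbolicity[OF assms] by (simp add: visual_le_iff)
qed

lemma visual_self_le:
  assumes "w \<in> V" "x \<in> V" "y \<in> V"
  shows "visual w x x \<le> visual w x y" "visual w x x \<le> visual w y x"
  using product_le[OF assms] product_self[of x w] product_sym[of x y w] assms rate_pos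
  by (auto simp: visual_def)

text \<open>
  Frink's argument. Cut the chain at the step where the partial sums pass half of the total sum:
  by induction the two remaining pieces are as small as the total sum, as is the step between
  them, and putting three pieces together costs a factor \<open>\<surd>2 * \<surd>2\<close>. The point is that the
  loss does not depend on the number of steps.
\<close>

lemma visual_chain:
  assumes "w \<in> V" "m < n" "\<And>i. m \<le> i \<Longrightarrow> i \<le> n \<Longrightarrow> a i \<in> V"
  shows "visual w (a m) (a n) \<le> 2 * (\<Sum>i = m..<n. visual w (a i) (a (Suc i)))"
  using assms(2,3)
proof (induction "n - m" arbitrary: m n rule: less_induct)
  case less
  note V = less.prems(2)
  define f where "f i = visual w (a i) (a (Suc i))" for i
  define s where "s = sum f {m..<n}"
  have f0: "0 < f i" for i
    by (simp add: f_def visual_pos)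
  have f_le: "f i \<le> s" if "m \<le> i" "i < n" for i
    unfolding s_def using that by (intro member_le_sum) (auto intro: less_imp_le f0)
  have s0: "0 < s"
    unfolding s_def using less.prems(1) by (intro sum_pos) (auto intro: f0)
  define k where "k = (GREATEST k. m \<le> k \<and> k < n \<and> sum f {m..<k} \<le> s / 2)"
  have k: "m \<le> k \<and> k < n \<and> sum f {m..<k} \<le> s / 2"
    unfolding k_def
    by (rule GreatestI_nat[where k = m and b = n]) (use less.prems(1) s0 in auto)
  have "s / 2 \<le> sum f {m..<Suc k}"
  proof (cases "Suc k < n")
    case True
    have "\<not> (m \<le> Suc k \<and> Suc k < n \<and> sum f {m..<Suc k} \<le> s / 2)"
      using Greatest_le_nat[of "\<lambda>k. m \<le> k \<and> k < n \<and> sum f {m..<k} \<le> s / 2" "Suc k" n]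
      unfolding k_def[symmetric] by auto
    then show ?thesis
      using True k by auto
  next
    case False
    then have "Suc k = n"
      using k by auto
    then show ?thesis
      using s0 by (simp add: s_def)
  qed
  moreover have "sum f {m..<Suc k} + sum f {Suc k..<n} = s"
    unfolding s_def using k by (intro sum.atLeastLessThan_concat) auto
  ultimately have right: "sum f {Suc k..<n} \<le> s / 2"
    by linarith
  \<comment> \<open>An empty piece still counts, as \<open>visual w x x\<close> is not \<open>0\<close>; the adjacent step dominates it.\<close>
  have 1: "visual w (a m) (a k) \<le> s"
  proof (cases "k = m")
    case True
    then show ?thesis
      using visual_self_le(1)[OF assms(1), of "a m" "a (Suc m)"] V f_le[of m] less.prems(1)
      by (auto simp: f_def)
  next
    case False
    then have "visual w (a m) (a k) \<le> 2 * sum f {m..<k}"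
      unfolding f_def using k V by (intro less.hyps) auto
    then show ?thesis
      using k by linarith
  qed
  have 2: "visual w (a (Suc k)) (a n) \<le> s"
  proof (cases "Suc k = n")
    case True
    then show ?thesis
      using visual_self_le(2)[OF assms(1), of "a n" "a k"] V f_le[of k] k
      by (auto simp: f_def)
  next
    case False
    then have "visual w (a (Suc k)) (a n) \<le> 2 * sum f {Suc k..<n}"
      unfolding f_def using k V by (intro less.hyps) auto
    then show ?thesis
      using right by linarith
  qed
  have "visual w (a k) (a n) \<le> sqrt 2 * max (visual w (a k) (a (Suc k))) (visual w (a (Suc k)) (a n))"
    using V k by (intro visual_ultrametric assms(1)) auto
  also have "\<dots> \<le> sqrt 2 * s"
    using 2 f_le[of k] k by (intro mult_left_mono) (auto simp: f_def)
  finally have 3: "visual w (a k) (a n) \<le> sqrt 2 * s" .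
  have "s \<le> sqrt 2 * s"
    using s0 by simp
  with 1 3 have "max (visual w (a m) (a k)) (visual w (a k) (a n)) \<le> sqrt 2 * s"
    by linarith
  moreover have "visual w (a m) (a n) \<le> sqrt 2 * max (visual w (a m) (a k)) (visual w (a k) (a n))"
    using V k less.prems(1) by (intro visual_ultrametric assms(1)) auto
  ultimately have "visual w (a m) (a n) \<le> sqrt 2 * (sqrt 2 * s)"
    by (meson mult_left_mono order_trans real_sqrt_ge_zero zero_le_numeral)
  also have "\<dots> = 2 * s"
    by simp
  finally show ?case
    unfolding s_def f_def .
qed

lemma visual_step_le:
  assumes "w \<in> V" "x \<in> V" "y \<in> V" "d x y \<le> L"
  shows "visual w x y \<le> exp (rate * L) * exp (- (rate * d x w))"
proof -
  have "exp (rate * L) * exp (- (rate * d x w)) = exp (- (rate * (d x w - L)))"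
    by (simp add: algebra_simps flip: exp_add)
  then show ?thesis
    using product_ge[OF assms(1-3)] assms(4) by (simp add: visual_le_iff)
qed

text \<open>
  By the chain inequality, the visual distance of two late terms is bounded by a tail of a
  convergent series.
\<close>

lemma converges_if_summable:
  assumes "w \<in> V" "\<And>i. a i \<in> V" "\<And>i. d (a i) (a (Suc i)) \<le> L"
    and sum: "summable (\<lambda>i. exp (- (rate * d (a i) w)))"
  shows "gromov_equiv d w a a"
proof -
  define f where "f i = visual w (a i) (a (Suc i))" for i
  have f0: "0 \<le> f i" for i
    using visual_pos by (simp add: f_def less_imp_le)
  have "summable f"
    using summable_mult[OF sum, of "exp (rate * L)"]
    by (rule summable_comparison_test')
      (use visual_step_le[OF assms(1)] assms(2,3) f0 in \<open>auto simp: f_def\<close>)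
  then have tail: "\<exists>N. \<forall>n\<ge>N. norm (\<Sum>i. f (i + n)) < r" if "0 < r" for r
    using suminf_exist_split[OF that] by blast
  have "\<exists>N. \<forall>m\<ge>N. \<forall>n\<ge>N. C \<le> gromov_product d w (a m) (a n)" for C
  proof -
    obtain N where N: "\<And>n. n \<ge> N \<Longrightarrow> norm (\<Sum>i. f (i + n)) < exp (- (rate * C)) / 2"
      using tail[of "exp (- (rate * C)) / 2"] by auto
    have later: "visual w (a m) (a n) \<le> exp (- (rate * C))" if "N \<le> m" "m < n" for m n
    proof -
      have "visual w (a m) (a n) \<le> 2 * sum f {m..<n}"
        unfolding f_def using assms that by (intro visual_chain) auto
      also have "sum f {m..<n} = (\<Sum>i<n - m. f (i + m))"
        by (rule sum.reindex_bij_witness[of _ "\<lambda>i. i + m" "\<lambda>i. i - m"]) (use that in auto)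
      also have "\<dots> \<le> (\<Sum>i. f (i + m))"
        using \<open>summable f\<close> f0 by (intro sum_le_suminf) (auto simp: summable_iff_shift)
      finally show ?thesis
        using N[OF that(1)] by simp
    qed
    have "C \<le> gromov_product d w (a m) (a n)" if "N \<le> m" "N \<le> n" for m n
    proof (cases m n rule: linorder_cases)
      case less
      then show ?thesis
        using \<open>N \<le> m\<close> later[of m n] by (simp add: visual_le_iff)
    next
      case equal
      have "visual w (a m) (a m) \<le> exp (- (rate * C))"
        using visual_self_le(1)[OF assms(1), of "a m" "a (Suc m)"] assms(2) \<open>N \<le> m\<close>
          later[of m "Suc m"] by force
      then show ?thesis
        using equal by (simp add: visual_le_iff)
    next
      case greater
      then show ?thesis
        using \<open>N \<le> n\<close> later[of n m] assms(2)
          product_sym[of "a n" "a m" w] by (simp add: visual_le_iff)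
    qed
    then show ?thesis
      by blast
  qed
  then show ?thesis
    unfolding gromov_equiv_def filterlim_at_top eventually_prod_sequentially by (simp, blast)
qed

text \<open>
  Since \<open>exp\<close> dominates the fourth power, a quadratic time bound makes the \<open>i\<close>-th term of
  the series \<open>O(1 / i\<^sup>2)\<close>.
\<close>

lemma converges_if_escapes:
  assumes "w \<in> V" "\<And>i. a i \<in> V" "\<And>i. d (a i) (a (Suc i)) \<le> L"
    and escape: "\<And>i. real i \<le> B * (1 + d (a i) w)\<^sup>2"
  shows "gromov_equiv d w a a"
proof (rule converges_if_summable[where L = L])
  define c where "c = 4 / rate"
  have c0: "0 < c"
    using rate_pos by (simp add: c_def)
  have bound: "exp (- (rate * d (a i) w)) \<le> (c ^ 4 * exp rate * B\<^sup>2) * (1 / real (i\<^sup>2))" if "1 \<le> i" for i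
  proof -
    define u where "u = 1 + d (a i) w"
    have u: "1 \<le> u"
      using dist_nonneg assms by (simp add: u_def)
    have "u / c \<le> exp (u / c)"
      using exp_ge_add_one_self[of "u / c"] by linarith
    then have "(u / c) ^ 4 \<le> exp (u / c) ^ 4"
      using u c0 by (intro power_mono) auto
    also have "\<dots> = exp (rate * u)"
      by (simp add: c_def flip: exp_of_nat_mult)
    finally have "u ^ 4 \<le> c ^ 4 * exp (rate * u)"
      using c0 by (simp add: power_divide field_simps)
    also have "rate * u = rate + rate * d (a i) w"
      by (simp add: u_def algebra_simps)
    finally have 1: "u ^ 4 * exp (- (rate * d (a i) w)) \<le> c ^ 4 * exp rate"
      by (simp add: exp_add exp_minus field_simps)
    have "(real i)\<^sup>2 \<le> (B * u\<^sup>2)\<^sup>2"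
      using escape[of i] by (intro power_mono) (auto simp: u_def)
    then have "(real i)\<^sup>2 * exp (- (rate * d (a i) w)) \<le> B\<^sup>2 * (u ^ 4 * exp (- (rate * d (a i) w)))"
      by (simp add: power_mult_distrib flip: power_mult mult.assoc)
    also have "\<dots> \<le> B\<^sup>2 * (c ^ 4 * exp rate)"
      using 1 by (intro mult_left_mono) auto
    finally show ?thesis
      using that by (simp add: field_simps)
  qed
  have "summable (\<lambda>i. (c ^ 4 * exp rate * B\<^sup>2) * (1 / real (i\<^sup>2)))"
    by (intro summable_mult) (use inverse_power_summable[of 2, where 'a = real] in \<open>simp add: field_simps\<close>)
  then show "summable (\<lambda>i. exp (- (rate * d (a i) w)))"
    by (rule summable_comparison_test'[where N = 1]) (use bound in auto)
qed (use assms in auto)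

end


section \<open>Sequences with a limit in the Gromov boundary\<close>

lemma gromov_equiv_iff:
  "gromov_equiv d w x y \<longleftrightarrow> (\<forall>C. \<exists>N. \<forall>i\<ge>N. \<forall>j\<ge>N. C \<le> gromov_product d w (x i) (y j))"
  unfolding gromov_equiv_def filterlim_at_top eventually_prod_sequentially
  by simp (intro all_cong1 ex_cong1 iffI allI impI; simp)

context hyperbolic_space
begin

definition boundary_rel :: "'a \<Rightarrow> ((nat \<Rightarrow> 'a) \<times> (nat \<Rightarrow> 'a)) set" where
  "boundary_rel w = {(x, y). x \<in> converging_at_infinity V d w \<and>
     y \<in> converging_at_infinity V d w \<and> gromov_equiv d w x y}"

lemma gromov_equiv_sym:
  assumes "range x \<subseteq> V" "range y \<subseteq> V" "gromov_equiv d w x y"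
  shows "gromov_equiv d w y x"
proof -
  have "gromov_product d w (y j) (x i) = gromov_product d w (x i) (y j)" for i j
    using assms by (intro product_sym) auto
  then show ?thesis
    using assms(3) unfolding gromov_equiv_iff by metis
qed

lemma gromov_equiv_trans:
  assumes w: "w \<in> V" and "range x \<subseteq> V" "range y \<subseteq> V" "range z \<subseteq> V"
    and "gromov_equiv d w x y" "gromov_equiv d w y z"
  shows "gromov_equiv d w x z"
  unfolding gromov_equiv_iff
proof
  fix C
  obtain M where M: "\<And>i j. i \<ge> M \<Longrightarrow> j \<ge> M \<Longrightarrow> C + \<delta> \<le> gromov_product d w (x i) (y j)"
    using assms(5) unfolding gromov_equiv_iff by meson
  obtain N where N: "\<And>i j. i \<ge> N \<Longrightarrow> j \<ge> N \<Longrightarrow> C + \<delta> \<le> gromov_product d w (y i) (z j)"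
    using assms(6) unfolding gromov_equiv_iff by meson
  have "C \<le> gromov_product d w (x i) (z j)" if "i \<ge> max M N" "j \<ge> max M N" for i j
    using hyperbolicity[OF w, of "x i" "y (max M N)" "z j"] M[of i "max M N"] N[of "max M N" j]
      that assms(2-4) by (auto simp: subset_iff)
  then show "\<exists>N. \<forall>i\<ge>N. \<forall>j\<ge>N. C \<le> gromov_product d w (x i) (z j)"
    by blast
qed

lemma equiv_boundary_rel:
  assumes "w \<in> V"
  shows "equiv (converging_at_infinity V d w) (boundary_rel w)"
proof (rule equivI)
  show "boundary_rel w \<subseteq> converging_at_infinity V d w \<times> converging_at_infinity V d w"
    by (auto simp: boundary_rel_def)
  show "refl_on (converging_at_infinity V d w) (boundary_rel w)"
    by (auto simp: refl_on_def boundary_rel_def converging_at_infinity_def)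
  show "sym (boundary_rel w)"
  proof (rule symI)
    fix x y
    assume "(x, y) \<in> boundary_rel w"
    then show "(y, x) \<in> boundary_rel w"
      using gromov_equiv_sym[of x y w] by (simp add: boundary_rel_def converging_at_infinity_def)
  qed
  show "trans (boundary_rel w)"
  proof (rule transI)
    fix x y z
    assume "(x, y) \<in> boundary_rel w" "(y, z) \<in> boundary_rel w"
    then show "(x, z) \<in> boundary_rel w"
      using gromov_equiv_trans[OF assms, of x y z]
      by (simp add: boundary_rel_def converging_at_infinity_def)
  qed
qed

lemma boundary_eq: "gromov_boundary V d w = converging_at_infinity V d w // boundary_rel w"
  by (simp add: gromov_boundary_def boundary_rel_def)

text \<open>
  If \<open>\<sigma>\<close> converges at infinity, then \<open>\<sigma>\<close> together with its limit is closed in the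
  compactification: any boundary point all of whose neighbourhoods meet this set is represented
  by \<open>\<sigma>\<close>. The basic neighbourhoods are not open in general, so that the definition of the
  topology is applied to the complement of this set instead.
\<close>

lemma closed_sequence_with_limit:
  assumes w: "w \<in> V" and \<sigma>: "\<sigma> \<in> converging_at_infinity V d w"
    and x: "x \<in> converging_at_infinity V d w"
    and meets: "\<And>r. gromov_nhd V d w (boundary_rel w `` {x}) r \<inter>
                  (Inl ` range \<sigma> \<union> {Inr (boundary_rel w `` {\<sigma>})}) \<noteq> {}"
  shows "boundary_rel w `` {x} = boundary_rel w `` {\<sigma>}"
proof -
  have V: "range x \<subseteq> V" "range \<sigma> \<subseteq> V"
    using x \<sigma> by (auto simp: converging_at_infinity_def)
  have conv: "gromov_equiv d w \<sigma> \<sigma>"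
    using \<sigma> by (simp add: converging_at_infinity_def)
  have "gromov_equiv d w x \<sigma>"
    unfolding gromov_equiv_iff
  proof
    fix C
    obtain N where N: "\<And>i j. i \<ge> N \<Longrightarrow> j \<ge> N \<Longrightarrow> C + 2 * \<delta> \<le> gromov_product d w (\<sigma> i) (\<sigma> j)"
      using conv unfolding gromov_equiv_iff by meson
    \<comment> \<open>At level \<open>R\<close>, the neighbourhood does not contain any of the terms before \<open>N\<close>.\<close>
    obtain R where R: "C + 3 * \<delta> \<le> R" "\<And>i. i < N \<Longrightarrow> d (\<sigma> i) w < R"
    proof -
      have "bdd_above ((\<lambda>i. d (\<sigma> i) w) ` {..<N})"
        by simp
      then obtain B where B: "\<And>i. i < N \<Longrightarrow> d (\<sigma> i) w \<le> B"
        by (auto simp: bdd_above_def)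
      have "d (\<sigma> i) w < max (C + 3 * \<delta>) (B + 1)" if "i < N" for i
        using B[OF that] by linarith
      then show ?thesis
        by (intro that[of "max (C + 3 * \<delta>) (B + 1)"]) auto
    qed
    have "\<exists>y\<in>boundary_rel w `` {x}. \<exists>i\<ge>N. \<exists>M. \<forall>j\<ge>M. R - \<delta> \<le> gromov_product d w (y j) (\<sigma> i)"
    proof -
      consider (vertex) k where "Inl (\<sigma> k) \<in> gromov_nhd V d w (boundary_rel w `` {x}) R"
        | (limit) "Inr (boundary_rel w `` {\<sigma>}) \<in> gromov_nhd V d w (boundary_rel w `` {x}) R"
        using meets[of R] by blast
      then show ?thesis
      proof cases
        case vertex
        then obtain y where y: "y \<in> boundary_rel w `` {x}"
          and ev: "\<forall>\<^sub>F i in sequentially. R \<le> gromov_product d w (y i) (\<sigma> k)"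
          unfolding gromov_nhd_def by blast
        obtain M where M: "\<And>j. j \<ge> M \<Longrightarrow> R \<le> gromov_product d w (y j) (\<sigma> k)"
          using ev unfolding eventually_sequentially by blast
        have "y M \<in> V" "\<sigma> k \<in> V"
          using y V by (auto simp: boundary_rel_def converging_at_infinity_def)
        then have "R \<le> d (\<sigma> k) w"
          using M[of M] product_le[OF w, of "\<sigma> k" "y M"] product_sym[of "y M" "\<sigma> k" w] by simp
        then have "k \<ge> N"
          using R(2)[of k] by force
        moreover have "R - \<delta> \<le> gromov_product d w (y j) (\<sigma> k)" if "j \<ge> M" for j
          using M[OF that] \<delta>_pos by simp
        ultimately show ?thesis
          using y by blast
      next
        case limit
        then obtain y z where y: "y \<in> boundary_rel w `` {x}" and z: "z \<in> boundary_rel w `` {\<sigma>}"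
          and ev: "\<forall>\<^sub>F (i, j) in sequentially \<times>\<^sub>F sequentially. R \<le> gromov_product d w (y i) (z j)"
          unfolding gromov_nhd_def by blast
        obtain M where M: "\<And>i j. i \<ge> M \<Longrightarrow> j \<ge> M \<Longrightarrow> R \<le> gromov_product d w (y i) (z j)"
          using ev unfolding eventually_prod_sequentially by auto
        have "gromov_equiv d w z \<sigma>"
          using z by (auto simp: boundary_rel_def converging_at_infinity_def intro: gromov_equiv_sym)
        then obtain N' where N': "\<And>i j. i \<ge> N' \<Longrightarrow> j \<ge> N' \<Longrightarrow> R \<le> gromov_product d w (z i) (\<sigma> j)"
          unfolding gromov_equiv_iff by meson
        define k where "k = Max {M, N, N'}"
        have k: "k \<ge> M" "k \<ge> N" "k \<ge> N'"
          by (auto simp: k_def)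
        have in_V: "y j \<in> V" "z k \<in> V" "\<sigma> k \<in> V" for j
          using y z V by (auto simp: boundary_rel_def converging_at_infinity_def)
        have "R - \<delta> \<le> gromov_product d w (y j) (\<sigma> k)" if "j \<ge> M" for j
          using hyperbolicity[OF w in_V(1)[of j] in_V(2,3)] M[OF that k(1)] N'[OF k(3) k(3)]
          by linarith
        then show ?thesis
          using y k(2) by blast
      qed
    qed
    then obtain y k M where y: "y \<in> boundary_rel w `` {x}" and k: "k \<ge> N"
      and M: "\<And>j. j \<ge> M \<Longrightarrow> R - \<delta> \<le> gromov_product d w (y j) (\<sigma> k)"
      by blast
    have "gromov_equiv d w x y"
      using y by (simp add: boundary_rel_def)
    then obtain M' where M': "\<And>i j. i \<ge> M' \<Longrightarrow> j \<ge> M' \<Longrightarrow> R \<le> gromov_product d w (x i) (y j)"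
      unfolding gromov_equiv_iff by meson
    have "C \<le> gromov_product d w (x i) (\<sigma> j)" if "i \<ge> max M' N" "j \<ge> max M' N" for i j
    proof -
      define l where "l = max M M'"
      have in_V: "x i \<in> V" "y l \<in> V" "\<sigma> k \<in> V" "\<sigma> j \<in> V"
        using y V by (auto simp: boundary_rel_def converging_at_infinity_def)
      have "R \<le> gromov_product d w (x i) (y l)" "R - \<delta> \<le> gromov_product d w (y l) (\<sigma> k)"
          "C + 2 * \<delta> \<le> gromov_product d w (\<sigma> k) (\<sigma> j)"
        using M' M N k that by (auto simp: l_def)
      then show ?thesis
        using hyperbolicity[OF w in_V(1,2,3)] hyperbolicity[OF w in_V(1,3,4)] R(1) \<delta>_pos by linarith
    qed
    then show "\<exists>N. \<forall>i\<ge>N. \<forall>j\<ge>N. C \<le> gromov_product d w (x i) (\<sigma> j)"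
      by blast
  qed
  then show ?thesis
    using x \<sigma> equiv_class_eq[OF equiv_boundary_rel[OF w]] by (simp add: boundary_rel_def)
qed

text \<open>
  If \<open>\<sigma>\<close> accumulated on another point \<open>\<eta>\<close>, then the complement of the closed set above would
  be a neighbourhood of \<open>\<eta>\<close> without terms of \<open>\<sigma>\<close>.
\<close>

lemma has_direction_if_converges:
  assumes w: "w \<in> V" and \<sigma>: "\<sigma> \<in> converging_at_infinity V d w"
  shows "\<exists>\<xi>\<in>gromov_boundary V d w. has_direction V d w \<sigma> \<xi>"
proof
  define \<xi> where "\<xi> = boundary_rel w `` {\<sigma>}"
  show \<xi>: "\<xi> \<in> gromov_boundary V d w"
    using \<sigma> by (auto simp: boundary_eq \<xi>_def intro: quotientI)
  have V: "range \<sigma> \<subseteq> V" and conv: "gromov_equiv d w \<sigma> \<sigma>"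
    using \<sigma> by (auto simp: converging_at_infinity_def)
  have "accumulates_on V d w \<sigma> \<xi>"
    unfolding accumulates_on_def
  proof (intro exI conjI)
    show "limitin (gromov_compactification V d w) (\<lambda>n. Inl (\<sigma> n)) (Inr \<xi>) sequentially"
      unfolding limitin_def
    proof (intro conjI allI impI)
      show "Inr \<xi> \<in> topspace (gromov_compactification V d w)"
        using \<xi> by (simp add: topspace_gromov_compactification)
      fix U
      assume "openin (gromov_compactification V d w) U \<and> Inr \<xi> \<in> U"
      then obtain r where r: "gromov_nhd V d w \<xi> r \<subseteq> U"
        by (auto simp: openin_gromov_compactification)
      have "\<sigma> \<in> \<xi>"
        using equiv_class_self[OF equiv_boundary_rel[OF w] \<sigma>] by (simp add: \<xi>_def)
      obtain N where N: "\<And>i j. i \<ge> N \<Longrightarrow> j \<ge> N \<Longrightarrow> r \<le> gromov_product d w (\<sigma> i) (\<sigma> j)"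
        using conv unfolding gromov_equiv_iff by meson
      have "Inl (\<sigma> n) \<in> gromov_nhd V d w \<xi> r" if "n \<ge> N" for n
      proof -
        have "\<forall>\<^sub>F i in sequentially. r \<le> gromov_product d w (\<sigma> i) (\<sigma> n)"
          using N that by (auto simp: eventually_sequentially)
        then show ?thesis
          using V \<open>\<sigma> \<in> \<xi>\<close> by (auto simp: gromov_nhd_def)
      qed
      then show "\<forall>\<^sub>F n in sequentially. Inl (\<sigma> n) \<in> U"
        using r by (auto simp: eventually_sequentially)
    qed
  qed simp
  moreover have "\<eta> = \<xi>" if \<eta>: "\<eta> \<in> gromov_boundary V d w" and acc: "accumulates_on V d w \<sigma> \<eta>" for \<eta>
  proof (rule ccontr)
    assume "\<eta> \<noteq> \<xi>"
    define F where "F = Inl ` range \<sigma> \<union> {Inr \<xi>}"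
    have "openin (gromov_compactification V d w)
        (topspace (gromov_compactification V d w) - F)"
      unfolding openin_gromov_compactification
    proof (intro conjI allI impI)
      fix \<zeta>
      assume "Inr \<zeta> \<in> topspace (gromov_compactification V d w) - F"
      then have "\<zeta> \<in> gromov_boundary V d w" "\<zeta> \<noteq> \<xi>"
        by (auto simp: topspace_gromov_compactification F_def)
      then obtain x where x: "x \<in> converging_at_infinity V d w" "\<zeta> = boundary_rel w `` {x}"
        by (auto simp: boundary_eq elim: quotientE)
      then obtain r where "gromov_nhd V d w \<zeta> r \<inter> F = {}"
        using closed_sequence_with_limit[OF w \<sigma> x(1)] \<open>\<zeta> \<noteq> \<xi>\<close> by (auto simp: \<xi>_def F_def)
      moreover have "gromov_nhd V d w \<zeta> r \<subseteq> topspace (gromov_compactification V d w)"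
        unfolding topspace_gromov_compactification gromov_nhd_def by blast
      ultimately show "\<exists>r. gromov_nhd V d w \<zeta> r \<subseteq> topspace (gromov_compactification V d w) - F"
        by blast
    qed (auto simp: topspace_gromov_compactification)
    moreover have "Inr \<eta> \<in> topspace (gromov_compactification V d w) - F"
      using \<eta> \<open>\<eta> \<noteq> \<xi>\<close> by (auto simp: topspace_gromov_compactification F_def)
    moreover obtain v where v: "range v \<subseteq> range \<sigma>"
      and lim: "limitin (gromov_compactification V d w) (\<lambda>n::nat. Inl (v n)) (Inr \<eta>) sequentially"
      using acc by (auto simp: accumulates_on_def)
    ultimately have "\<forall>\<^sub>F n in sequentially. Inl (v n) \<in> topspace (gromov_compactification V d w) - F"
      unfolding limitin_def by blast
    then obtain n where "Inl (v n) \<notin> F"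
      unfolding eventually_sequentially by blast
    then show False
      using v by (auto simp: F_def)
  qed
  ultimately show "has_direction V d w \<sigma> \<xi>"
    by (auto simp: has_direction_def)
qed

end


section \<open>Invariance of hyperbolicity under a change of metric\<close>

definition discretely_geodesic :: "'a set \<Rightarrow> ('a \<Rightarrow> 'a \<Rightarrow> real) \<Rightarrow> bool" where
  "discretely_geodesic V e \<longleftrightarrow> (\<forall>x\<in>V. \<forall>y\<in>V. \<exists>c n. c 0 = x \<and> c n = y \<and> (\<forall>i\<le>n. c i \<in> V) \<and>
     (\<forall>i\<le>n. \<forall>j\<le>n. e (c i) (c j) = \<bar>real i - real j\<bar>))"

context hyperbolic_space
begin

text \<open>
  The sum of a geometric series with ratio \<open>exp (- rate * \<theta> / L)\<close>, and the factor \<open>2\<close> of the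
  chain inequality, expressed as a loss in Gromov products.
\<close>

definition follow_loss :: "real \<Rightarrow> real \<Rightarrow> real" where
  "follow_loss L \<theta> = 2 * L + ln (2 / (1 - exp (- (rate * (\<theta> / L))))) / rate"

lemma follow_loss_ge:
  assumes "0 < L" "0 < \<theta>"
  shows "2 * L \<le> follow_loss L \<theta>"
proof -
  define q where "q = exp (- (rate * (\<theta> / L)))"
  have "0 < q" "q < 1"
    using assms rate_pos by (auto simp: q_def)
  then have "0 \<le> ln (2 / (1 - q))"
    by (intro ln_ge_zero) (simp add: field_simps)
  then show ?thesis
    using rate_pos unfolding follow_loss_def q_def[symmetric] by simp
qed

text \<open>
  A sequence escaping at linear speed leaves the ball of radius \<open>r\<close> for the last time at a point
  whose Gromov product with the end of the sequence is nearly as large as possible, namely \<open>r\<close>.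
  Indeed, the later points lie outside of that ball and, in the long run, far outside of it.
  Interpolating between both bounds, with a small weight \<open>\<theta>\<close> on the second one, makes the
  sum in the chain inequality geometric.
\<close>

lemma linear_escape_follows_end:
  assumes L: "1 \<le> L" and \<theta>: "0 < \<theta>" "\<theta> \<le> 1"
    and V: "\<And>i. i \<le> n \<Longrightarrow> a i \<in> V"
    and step: "\<And>i. i < n \<Longrightarrow> d (a i) (a (Suc i)) \<le> L"
    and speed: "\<And>i. i \<le> n \<Longrightarrow> real i / L \<le> d (a i) (a 0)"
    and r: "0 \<le> r" "r \<le> d (a n) (a 0)"
  shows "\<exists>i\<le>n. r - L \<le> d (a i) (a 0) \<and> d (a i) (a 0) \<le> r \<and>
           (1 - \<theta>) * r - follow_loss L \<theta> \<le> gromov_product d (a 0) (a i) (a n)"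
proof -
  define w where "w = a 0"
  have w: "w \<in> V"
    using V by (simp add: w_def)
  define i where "i = (GREATEST i. i \<le> n \<and> d (a i) w \<le> r)"
  have i: "i \<le> n \<and> d (a i) w \<le> r"
    unfolding i_def by (rule GreatestI_nat[where k = 0 and b = n]) (use r w in \<open>auto simp: w_def dist_self\<close>)
  have outside: "r < d (a m) w" if "i < m" "m \<le> n" for m
  proof (rule ccontr)
    assume "\<not> r < d (a m) w"
    then have "m \<le> n \<and> d (a m) w \<le> r"
      using that by simp
    then have "m \<le> i"
      unfolding i_def by (rule Greatest_le_nat[where b = n]) auto
    then show False
      using that by simp
  qed
  have loss: "2 * L \<le> follow_loss L \<theta>"
    using L \<theta> by (intro follow_loss_ge) auto
  have near: "r - L \<le> d (a i) w"
  proof (cases "i = n")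
    case True
    then show ?thesis
      using r L by (simp add: w_def)
  next
    case False
    then have "d (a (Suc i)) w \<le> d (a i) (a (Suc i)) + d (a i) w"
      using i V w dist_triangle[of "a (Suc i)" "a i" w] dist_sym[of "a (Suc i)" "a i"] by auto
    then show ?thesis
      using outside[of "Suc i"] step[of i] i False by auto
  qed
  have "(1 - \<theta>) * r - follow_loss L \<theta> \<le> gromov_product d w (a i) (a n)"
  proof (cases "i = n")
    case True
    have "0 \<le> \<theta> * r"
      using r \<theta> by simp
    then have "(1 - \<theta>) * r - follow_loss L \<theta> \<le> r"
      using loss L by (simp add: algebra_simps)
    then show ?thesis
      using True r V[of n] product_self[of "a n" w] by (simp add: w_def)
  next
    case False
    define q where "q = exp (- (rate * (\<theta> / L)))"
    have q: "0 < q" "q < 1"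
      using rate_pos L \<theta> by (auto simp: q_def)
    define A where "A = exp (rate * (2 * L - (1 - \<theta>) * r))"
    have "visual w (a m) (a (Suc m)) \<le> A * q ^ m" if "i \<le> m" "m < n" for m
    proof -
      have 1: "r - L \<le> d (a m) w"
        using near outside[of m] that L by (cases "m = i") auto
      have 2: "real m / L \<le> d (a m) w"
        using speed[of m] that by (simp add: w_def)
      have "(1 - \<theta>) * (r - L) + \<theta> * (real m / L) \<le> (1 - \<theta>) * d (a m) w + \<theta> * d (a m) w"
        using 1 2 \<theta> by (intro add_mono mult_left_mono) auto
      moreover have "0 \<le> \<theta> * L"
        using L \<theta> by simp
      ultimately have "(1 - \<theta>) * r - L + \<theta> / L * real m \<le> d (a m) w"
        by (simp add: algebra_simps)
      then have "rate * ((1 - \<theta>) * r - L + \<theta> / L * real m) \<le> rate * d (a m) w"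
        using rate_pos by simp
      then have "exp (rate * L) * exp (- (rate * d (a m) w))
          \<le> exp (rate * L) * exp (- (rate * ((1 - \<theta>) * r - L + \<theta> / L * real m)))"
        by simp
      also have "\<dots> = A * q ^ m"
        by (simp add: A_def q_def algebra_simps flip: exp_add exp_of_nat_mult)
      finally show ?thesis
        using visual_step_le[OF w _ _ step[of m]] V that by force
    qed
    then have "visual w (a i) (a n) \<le> 2 * (\<Sum>m = i..<n. A * q ^ m)"
      using visual_chain[OF w, of i n a] V i False
      by (smt (verit) atLeastLessThan_iff le_neq_implies_less sum_mono)
    also have "(\<Sum>m = i..<n. A * q ^ m) \<le> A * (1 / (1 - q))"
    proof -
      have "(\<Sum>m = i..<n. q ^ m) \<le> (\<Sum>m. q ^ m)"
        using q by (intro sum_le_suminf) auto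
      then have "(\<Sum>m = i..<n. q ^ m) \<le> 1 / (1 - q)"
        using q by (simp add: suminf_geometric)
      then have "A * (\<Sum>m = i..<n. q ^ m) \<le> A * (1 / (1 - q))"
        by (intro mult_left_mono) (auto simp: A_def)
      then show ?thesis
        by (simp only: sum_distrib_left)
    qed
    also have "2 * (A * (1 / (1 - q))) = exp (- (rate * ((1 - \<theta>) * r - follow_loss L \<theta>)))"
    proof -
      have "2 / (1 - q) = exp (rate * (ln (2 / (1 - q)) / rate))"
        using q rate_pos by simp
      then have "2 * (A * (1 / (1 - q)))
          = exp (rate * (2 * L - (1 - \<theta>) * r)) * exp (rate * (ln (2 / (1 - q)) / rate))"
        by (simp add: A_def)
      also have "\<dots> = exp (rate * (2 * L - (1 - \<theta>) * r) + rate * (ln (2 / (1 - q)) / rate))"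
        by (simp only: exp_add)
      also have "rate * (2 * L - (1 - \<theta>) * r) + rate * (ln (2 / (1 - q)) / rate)
          = - (rate * ((1 - \<theta>) * r - follow_loss L \<theta>))"
        unfolding follow_loss_def q_def[symmetric] by (simp only: algebra_simps)
      finally show ?thesis .
    qed
    finally show ?thesis
      by (simp add: visual_le_iff)
  qed
  then show ?thesis
    using i near by (auto simp: w_def)
qed

definition morse_const :: "real \<Rightarrow> real" where
  "morse_const L = L\<^sup>2 * (2 * follow_loss L (1 / (2 * L\<^sup>2)) + 4 * \<delta>) + 2 * L"

text \<open>
  Stability of quasi-geodesics: all points of a quasi-geodesic are close to a geodesic between
  its ends. If the Gromov product \<open>r\<close> of the ends were large when seen from \<open>c k\<close>, then
  the last exits from the ball of radius \<open>r\<close> in both directions would be close to each other by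
  the previous lemma and hyperbolicity, although the quasi-geodesic needs a time proportional to
  \<open>r\<close> to get from one to the other.
\<close>

lemma quasi_geodesic_product_le:
  assumes L: "1 \<le> L"
    and V: "\<And>i. i \<le> N \<Longrightarrow> c i \<in> V"
    and step: "\<And>i. i < N \<Longrightarrow> d (c i) (c (Suc i)) \<le> L"
    and lower: "\<And>i j. i \<le> N \<Longrightarrow> j \<le> N \<Longrightarrow> \<bar>real i - real j\<bar> / L \<le> d (c i) (c j)"
    and k: "k \<le> N"
  shows "gromov_product d (c k) (c 0) (c N) \<le> morse_const L"
proof -
  \<comment> \<open>With this \<open>\<theta>\<close>, the exits have distance at most \<open>2 * \<theta> * r = r / L\<^sup>2\<close> up to a constant,
    which is half of the lower bound that their separation in time gives.\<close>
  define \<theta> where "\<theta> = 1 / (2 * L\<^sup>2)"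
  have "1 \<le> L\<^sup>2"
    using L by simp
  then have \<theta>: "0 < \<theta>" "\<theta> \<le> 1"
    unfolding \<theta>_def by (auto simp: divide_le_eq)
  define C where "C = follow_loss L \<theta>"
  have C: "0 \<le> C"
    using follow_loss_ge[of L \<theta>] L \<theta> by (simp add: C_def)
  define w where "w = c k"
  define r where "r = gromov_product d w (c 0) (c N)"
  have w: "w \<in> V" and ends: "c 0 \<in> V" "c N \<in> V"
    using V k by (auto simp: w_def)
  have r: "0 \<le> r" "r \<le> d (c 0) w" "r \<le> d (c N) w"
    using product_nonneg[OF w ends] product_le[OF w ends] product_le[OF w ends(2,1)] ends
      product_sym[of "c 0" "c N" w] by (auto simp: r_def)
  have "\<exists>i\<le>N - k. r - L \<le> d (c (k + i)) (c (k + 0)) \<and> d (c (k + i)) (c (k + 0)) \<le> r \<and>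
      (1 - \<theta>) * r - follow_loss L \<theta> \<le> gromov_product d (c (k + 0)) (c (k + i)) (c (k + (N - k)))"
    using L \<theta> V step k r
    by (intro linear_escape_follows_end[where a = "\<lambda>i. c (k + i)"])
      (auto simp: w_def intro: order_trans[OF _ lower])
  then obtain i where i: "i \<le> N - k" "r - L \<le> d (c (k + i)) w" "d (c (k + i)) w \<le> r"
      "(1 - \<theta>) * r - C \<le> gromov_product d w (c (k + i)) (c N)"
    using k by (auto simp: w_def C_def)
  have backward: "d (c (k - m)) (c (k - Suc m)) \<le> L" if "m < k" for m
    using step[of "k - Suc m"] that k dist_sym[of "c (k - m)" "c (k - Suc m)"] V
    by (simp add: Suc_diff_Suc)
  have "\<exists>j\<le>k. r - L \<le> d (c (k - j)) (c (k - 0)) \<and> d (c (k - j)) (c (k - 0)) \<le> r \<and>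
      (1 - \<theta>) * r - follow_loss L \<theta> \<le> gromov_product d (c (k - 0)) (c (k - j)) (c (k - k))"
    using L \<theta> V backward k r
    by (intro linear_escape_follows_end[where a = "\<lambda>j. c (k - j)"])
      (auto simp: w_def of_nat_diff intro: order_trans[OF _ lower])
  then obtain j where j: "j \<le> k" "r - L \<le> d (c (k - j)) w" "d (c (k - j)) w \<le> r"
      "(1 - \<theta>) * r - C \<le> gromov_product d w (c (k - j)) (c 0)"
    using k by (auto simp: w_def C_def)
  define x y where "x = c (k - j)" and "y = c (k + i)"
  have xy: "x \<in> V" "y \<in> V"
    using V k i(1) by (auto simp: x_def y_def)
  define t where "t = (1 - \<theta>) * r - C"
  have "0 \<le> \<theta> * r"
    using \<theta> r by simp
  then have "t \<le> r"
    using C by (simp add: t_def algebra_simps)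
  then have "t - \<delta> \<le> gromov_product d w x (c N)"
    using hyperbolicity[OF w xy(1) ends] j(4) by (simp add: t_def x_def r_def)
  then have "t - 2 * \<delta> \<le> gromov_product d w x y"
    using hyperbolicity[OF w xy(1) ends(2) xy(2)] i(4) product_sym[of y "c N" w] xy ends \<delta>_pos
    by (simp add: t_def y_def)
  then have upper: "d x y \<le> 2 * \<theta> * r + 2 * C + 4 * \<delta>"
    using i(3) j(3) by (simp add: gromov_product_def x_def y_def t_def algebra_simps)
  have speed_forward: "d (c (k + m)) w \<le> L * real m" if "k + m \<le> N" for m
    using that
  proof (induction m)
    case 0
    then show ?case
      using w by (simp add: w_def dist_self)
  next
    case (Suc m)
    then show ?case
      using step[of "k + m"] V w dist_triangle[of "c (k + Suc m)" "c (k + m)" w]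
        dist_sym[of "c (k + Suc m)" "c (k + m)"] by (simp add: algebra_simps)
  qed
  have speed_back: "d (c (k - m)) w \<le> L * real m" if "m \<le> k" for m
    using that
  proof (induction m)
    case 0
    then show ?case
      using w by (simp add: w_def dist_self)
  next
    case (Suc m)
    then show ?case
      using backward[of m] V w k dist_triangle[of "c (k - Suc m)" "c (k - m)" w]
        dist_sym[of "c (k - Suc m)" "c (k - m)"] by (simp add: algebra_simps)
  qed
  have "r - L \<le> L * real i"
  proof -
    have "k + i \<le> N"
      using i(1) k by linarith
    then show ?thesis
      using i(2) speed_forward[of i] by linarith
  qed
  moreover have "r - L \<le> L * real j"
    using j(1,2) speed_back[of j] by simp
  ultimately have "2 * (r - L) / L \<le> real i + real j"
    using L by (simp add: field_simps)
  then have "2 * (r - L) / L / L \<le> (real i + real j) / L"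
    using L by (intro divide_right_mono) auto
  also have "\<dots> = \<bar>real (k - j) - real (k + i)\<bar> / L"
    using j(1) by (simp add: of_nat_diff)
  also have "\<dots> \<le> d x y"
    unfolding x_def y_def using k i(1) by (intro lower) auto
  also note upper
  finally have "2 * (r - L) / L / L * L\<^sup>2 \<le> (2 * \<theta> * r + 2 * C + 4 * \<delta>) * L\<^sup>2"
    by (intro mult_right_mono) auto
  also have "2 * (r - L) / L / L * L\<^sup>2 = 2 * (r - L)"
    using L by (simp add: power2_eq_square)
  also have "(2 * \<theta> * r + 2 * C + 4 * \<delta>) * L\<^sup>2
      = 2 * \<theta> * r * L\<^sup>2 + L\<^sup>2 * (2 * C + 4 * \<delta>)"
    by (simp add: algebra_simps)
  also have "2 * \<theta> * r * L\<^sup>2 = r"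
    using L by (simp add: \<theta>_def)
  finally have "r \<le> L\<^sup>2 * (2 * C + 4 * \<delta>) + 2 * L"
    by (simp add: algebra_simps)
  then show ?thesis
    by (simp add: morse_const_def r_def w_def C_def \<theta>_def)
qed

text \<open>
  The geodesics of the second metric are quasi-geodesics of the first one. Hence a point
  \<open>p\<close> on such a geodesic from \<open>x\<close> to \<open>y\<close> has a small Gromov product \<open>(x | y)\<^sub>p\<close>
  in the first metric. Moving \<open>p\<close> from \<open>x\<close> to \<open>y\<close>, at some moment \<open>(x | w)\<^sub>p\<close> stops being
  small and then \<open>(y | w)\<^sub>p\<close> is small, so that there is a centre \<open>p\<close> of the triangle
  \<open>x, y, w\<close> on the geodesic. These centres carry bounds on Gromov products from one metric to
  the other, and with them the slimness of triangles.
\<close>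

theorem bilipschitz_geodesic_hyperbolic:
  assumes e: "pseudometric_on V e" and geod: "discretely_geodesic V e"
    and L: "1 \<le> L"
    and de: "\<And>x y. x \<in> V \<Longrightarrow> y \<in> V \<Longrightarrow> d x y \<le> L * e x y"
    and ed: "\<And>x y. x \<in> V \<Longrightarrow> y \<in> V \<Longrightarrow> e x y \<le> L * d x y"
  shows "gromov_hyperbolic V e"
proof -
  interpret e: pseudometric_on V e
    by fact
  define K where "K = max 0 (morse_const L)"
  define K' where "K' = K + \<delta> + L"
  have centre: "\<exists>p\<in>V. e x p + e p y = e x y \<and> gromov_product d p x y \<le> K \<and>
      gromov_product d p x w \<le> K' \<and> gromov_product d p y w \<le> K'"
    if x: "x \<in> V" and y: "y \<in> V" and w: "w \<in> V" for x y w
  proof -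
    obtain c n where c: "c 0 = x" "c n = y" "\<And>i. i \<le> n \<Longrightarrow> c i \<in> V"
      and ec: "\<And>i j. i \<le> n \<Longrightarrow> j \<le> n \<Longrightarrow> e (c i) (c j) = \<bar>real i - real j\<bar>"
      using geod x y unfolding discretely_geodesic_def by metis
    have step: "d (c i) (c (Suc i)) \<le> L" if "i < n" for i
      using de[of "c i" "c (Suc i)"] ec[of i "Suc i"] c that by simp
    have "\<bar>real i - real j\<bar> / L \<le> d (c i) (c j)" if "i \<le> n" "j \<le> n" for i j
      using ed[of "c i" "c j"] ec[of i j] c that L by (simp add: field_simps)
    then have M: "gromov_product d (c k) x y \<le> K" if "k \<le> n" for k
      using quasi_geodesic_product_le[of L n c k] L c step that by (simp add: K_def)
    have between: "e x (c k) + e (c k) y = e x y" if "k \<le> n" for k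
      using ec[of 0 k] ec[of k n] ec[of 0 n] c that by simp
    have zero: "gromov_product d z z w \<le> K'" if "z \<in> V" for z
      using that w dist_self[of z] dist_sym[of z w] L \<delta>_pos
      by (simp add: gromov_product_def K'_def K_def)
    define k where "k = (GREATEST k. k \<le> n \<and> gromov_product d (c k) x w \<le> K')"
    have k: "k \<le> n \<and> gromov_product d (c k) x w \<le> K'"
      unfolding k_def by (rule GreatestI_nat[where k = 0 and b = n]) (use c x zero in auto)
    have "gromov_product d (c k) y w \<le> K'"
    proof (cases "k = n")
      case True
      then show ?thesis
        using zero y c by simp
    next
      case False
      then have "Suc k \<le> n"
        using k by simp
      moreover have "\<not> (Suc k \<le> n \<and> gromov_product d (c (Suc k)) x w \<le> K')"
        using Greatest_le_nat[of "\<lambda>k. k \<le> n \<and> gromov_product d (c k) x w \<le> K'" "Suc k" n]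
        unfolding k_def[symmetric] by auto
      ultimately have "K + \<delta> < gromov_product d (c (Suc k)) x w"
        using L by (simp add: K'_def)
      then have "gromov_product d (c (Suc k)) w y \<le> K + \<delta>"
        using hyperbolicity[of "c (Suc k)" x w y] M[of "Suc k"] c x y w \<open>Suc k \<le> n\<close> by force
      then show ?thesis
        using product_change_base[of "c k" "c (Suc k)" y w] product_sym[of w y] step[of k] c y w
          \<open>Suc k \<le> n\<close> dist_sym[of "c k" "c (Suc k)"] by (force simp: K'_def)
    qed
    then show ?thesis
      using k M between c by blast
  qed
  define f where "f = L * (3 * K')"
  have transfer: "gromov_product e p x y \<le> f"
    if V: "x \<in> V" "y \<in> V" "p \<in> V" and small: "gromov_product d p x y \<le> K'" for x y p
  proof -
    obtain q where q: "q \<in> V" "e x q + e q y = e x y"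
        "gromov_product d q x p \<le> K'" "gromov_product d q y p \<le> K'"
      using centre[OF V] by blast
    have "d q p \<le> gromov_product d p x y + 2 * K'"
      using q(3,4) dist_triangle[of x q y] dist_sym[of p q] dist_sym[of q y] V q(1)
      by (simp add: gromov_product_def field_simps)
    then have "d q p \<le> 3 * K'"
      using small by simp
    then have "L * d q p \<le> f"
      using L by (simp add: f_def)
    then have "e q p \<le> f"
      using ed[of q p] V q(1) by linarith
    moreover have "gromov_product e q x y = 0"
      using q(2) e.dist_sym[of q y] q(1) V by (simp add: gromov_product_def)
    ultimately show ?thesis
      using e.product_change_base[of p q x y] V q(1) by linarith
  qed
  have "min (gromov_product e w x y) (gromov_product e w y z) - 3 * f \<le> gromov_product e w x z"
    if V: "w \<in> V" "x \<in> V" "y \<in> V" "z \<in> V" for w x y z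
  proof -
    obtain p where p: "p \<in> V" "e x p + e p z = e x z" "gromov_product d p x z \<le> K"
        "gromov_product d p x w \<le> K'" "gromov_product d p z w \<le> K'"
      using centre[OF V(2,4,1)] by blast
    have "gromov_product e p x w \<le> f" "gromov_product e p z w \<le> f"
      using transfer p V by auto
    then have 1: "e p w - 2 * f \<le> gromov_product e w x z"
      using p(2) e.dist_sym[of p w] e.dist_sym[of p z] p(1) V
      by (simp add: gromov_product_def field_simps)
    have "min (gromov_product d p x y) (gromov_product d p y z) \<le> K'"
      using hyperbolicity[OF p(1) V(2,3,4)] p(3) L by (simp add: K'_def)
    then have "min (gromov_product e p x y) (gromov_product e p y z) \<le> f"
      using transfer[OF V(2,3) p(1)] transfer[OF V(3,4) p(1)] by linarith
    then have "min (gromov_product e w x y) (gromov_product e w y z) \<le> f + e p w"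
      using e.product_change_base[OF V(1) p(1) V(2,3)] e.product_change_base[OF V(1) p(1) V(3,4)]
      by linarith
    then show ?thesis
      using 1 by linarith
  qed
  then show ?thesis
    unfolding gromov_hyperbolic_def by blast
qed

end


section \<open>Paths and distances in graphs\<close>

lemma path_length_single [simp]: "path_length \<omega> [x] = 0"
  by (simp add: path_length_def)

lemma path_length_Cons [simp]: "path_length \<omega> (x # y # p) = \<omega> {x, y} + path_length \<omega> (y # p)"
  unfolding path_length_def by (simp add: sum.lessThan_Suc_shift del: sum.lessThan_Suc)

lemma path_length_append:
  "p \<noteq> [] \<Longrightarrow> path_length \<omega> (p @ q) = path_length \<omega> p + path_length \<omega> (last p # q)"
  by (induction p rule: induct_list012) auto

lemma path_length_one: "path_length (\<lambda>_. 1) p = real (length p - 1)"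
  by (simp add: path_length_def)

lemma edge_path_single: "x \<in> V \<Longrightarrow> edge_path V E [x]"
  by (simp add: edge_path_def)

lemma edge_path_append:
  assumes "edge_path V E p" "edge_path V E q" "last p = hd q"
  shows "edge_path V E (p @ tl q)" "hd (p @ tl q) = hd p" "last (p @ tl q) = last q"
    "path_length \<omega> (p @ tl q) = path_length \<omega> p + path_length \<omega> q"
proof -
  obtain y q' where q: "q = y # q'"
    using assms(2) by (cases q) (auto simp: edge_path_def)
  show "edge_path V E (p @ tl q)"
    using assms q by (auto simp: edge_path_def successively_append_iff successively_Cons)
  show "hd (p @ tl q) = hd p" "last (p @ tl q) = last q"
    using assms q by (auto simp: edge_path_def)
  show "path_length \<omega> (p @ tl q) = path_length \<omega> p + path_length \<omega> q"
    using assms q by (auto simp: edge_path_def path_length_append)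
qed

lemma edge_path_rev: "edge_path V E p \<Longrightarrow> edge_path V E (rev p)"
  by (simp add: edge_path_def insert_commute)

lemma edge_path_nth:
  assumes "edge_path V E p" "Suc i < length p"
  shows "{p ! i, p ! Suc i} \<in> E"
  using assms by (auto simp: edge_path_def successively_conv_nth)

lemma path_length_nonneg:
  "edge_path V E p \<Longrightarrow> (\<And>e. e \<in> E \<Longrightarrow> 0 \<le> \<omega> e) \<Longrightarrow> 0 \<le> path_length \<omega> p"
  unfolding path_length_def by (intro sum_nonneg) (auto intro!: edge_path_nth simp: less_diff_conv)

lemma fpp_dist_le:
  assumes "edge_path V E p" "\<And>e. e \<in> E \<Longrightarrow> 0 \<le> \<omega> e"
  shows "fpp_dist V E \<omega> (hd p) (last p) \<le> path_length \<omega> p"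
  unfolding fpp_dist_def
  by (intro cINF_lower bdd_belowI2[where m = 0])
    (use assms path_length_nonneg in \<open>auto intro: path_length_nonneg\<close>)

lemma graph_dist_le:
  "edge_path V E p \<Longrightarrow> graph_dist V E (hd p) (last p) \<le> real (length p - 1)"
  using fpp_dist_le[of V E p "\<lambda>_. 1"] by (simp add: graph_dist_def path_length_one)

locale connected_graph =
  fixes V :: "'a set" and E :: "'a set set"
  assumes connected: "x \<in> V \<Longrightarrow> y \<in> V \<Longrightarrow> \<exists>p. edge_path V E p \<and> hd p = x \<and> last p = y"
begin

lemma shortest_path:
  assumes "x \<in> V" "y \<in> V"
  obtains p where "edge_path V E p" "hd p = x" "last p = y"
    "graph_dist V E x y = real (length p - 1)"
proof -
  let ?P = "{p. edge_path V E p \<and> hd p = x \<and> last p = y}"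
  obtain p where p: "p \<in> ?P" "\<And>q. q \<in> ?P \<Longrightarrow> length p \<le> length q"
    using connected[OF assms] exists_least_iff[of "\<lambda>n. \<exists>p\<in>?P. length p = n"]
    by (metis (mono_tags, lifting) mem_Collect_eq not_le)
  have "graph_dist V E x y = real (length p - 1)"
    unfolding graph_dist_def fpp_dist_def path_length_one
    by (rule cInf_eq_minimum) (use p in \<open>auto intro!: diff_le_mono\<close>)
  then show ?thesis
    using p(1) that by blast
qed

lemma pseudometric_graph_dist: "pseudometric_on V (graph_dist V E)"
proof
  have le: "graph_dist V E y x \<le> graph_dist V E x y" if xy: "x \<in> V" "y \<in> V" for x y
  proof -
    obtain p where "edge_path V E p" "hd p = x" "last p = y"
        "graph_dist V E x y = real (length p - 1)"
      by (rule shortest_path[OF xy])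
    then show ?thesis
      using graph_dist_le[OF edge_path_rev, of V E p] by (simp add: hd_rev last_rev)
  qed
  show "graph_dist V E x y = graph_dist V E y x" if "x \<in> V" "y \<in> V" for x y
    using le that by (simp add: order_antisym)
  have nonneg: "0 \<le> graph_dist V E x y" if xy: "x \<in> V" "y \<in> V" for x y
    by (rule shortest_path[OF xy]) simp
  show "graph_dist V E x x = 0" if "x \<in> V" for x
    using graph_dist_le[OF edge_path_single, OF that, of E] nonneg[of x x] that by simp
  show "graph_dist V E x z \<le> graph_dist V E x y + graph_dist V E y z"
    if xyz: "x \<in> V" "y \<in> V" "z \<in> V" for x y z
  proof -
    obtain p where p: "edge_path V E p" "hd p = x" "last p = y"
        "graph_dist V E x y = real (length p - 1)"
      by (rule shortest_path[OF xyz(1,2)])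
    obtain q where q: "edge_path V E q" "hd q = y" "last q = z"
        "graph_dist V E y z = real (length q - 1)"
      by (rule shortest_path[OF xyz(2,3)])
    have pq: "last p = hd q"
      using p q by simp
    show ?thesis
      using graph_dist_le[OF edge_path_append(1)[OF p(1) q(1) pq]] p q
        edge_path_append(2,3)[OF p(1) q(1) pq] edge_path_append(4)[OF p(1) q(1) pq, of "\<lambda>_. 1"]
      by (simp add: path_length_one)
  qed
qed

sublocale pseudometric_on V "graph_dist V E"
  by (rule pseudometric_graph_dist)

lemma dist_adjacent: "x \<in> V \<Longrightarrow> y \<in> V \<Longrightarrow> {x, y} \<in> E \<Longrightarrow> graph_dist V E x y \<le> 1"
  using graph_dist_le[of V E "[x, y]"] by (simp add: edge_path_def)

lemma shortest_path_geodesic: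
  assumes p: "edge_path V E p" "graph_dist V E (hd p) (last p) = real (length p - 1)"
    and "i < length p" "j < length p"
  shows "graph_dist V E (p ! i) (p ! j) = \<bar>real i - real j\<bar>"
proof -
  have V: "p ! i \<in> V" if "i < length p" for i
    using p(1) that by (auto simp: edge_path_def)
  have le: "graph_dist V E (p ! i) (p ! (i + k)) \<le> real k" if "i + k < length p" for i k
    using that
  proof (induction k)
    case 0
    then show ?case
      using V dist_self by simp
  next
    case (Suc k)
    then show ?case
      using dist_adjacent[of "p ! (i + k)" "p ! (i + Suc k)"] edge_path_nth[OF p(1), of "i + k"] V
        dist_triangle[of "p ! i" "p ! (i + k)" "p ! (i + Suc k)"] by simp
  qed
  have "graph_dist V E (p ! i) (p ! j) = real j - real i" if ij: "i \<le> j" "j < length p" for i j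
  proof -
    define n where "n = length p - 1"
    have n: "p ! n \<in> V" "p ! 0 \<in> V" "graph_dist V E (p ! 0) (p ! n) = real n" "j \<le> n" "n < length p"
      using p V ij by (auto simp: n_def hd_conv_nth last_conv_nth edge_path_def)
    have "graph_dist V E (p ! 0) (p ! i) \<le> real i" "graph_dist V E (p ! i) (p ! j) \<le> real (j - i)"
        "graph_dist V E (p ! j) (p ! n) \<le> real (n - j)"
      using le[of 0 i] le[of i "j - i"] le[of j "n - j"] n ij by auto
    then show ?thesis
      using dist_triangle[of "p ! 0" "p ! i" "p ! n"] dist_triangle[of "p ! i" "p ! j" "p ! n"]
        V ij n by (simp add: of_nat_diff)
  qed
  from this[of i j] this[of j i] show ?thesis
    using assms(3,4) V dist_sym[of "p ! i" "p ! j"] by (cases "i \<le> j") auto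
qed

lemma discretely_geodesic_graph_dist: "discretely_geodesic V (graph_dist V E)"
  unfolding discretely_geodesic_def
proof (intro ballI)
  fix x y
  assume "x \<in> V" "y \<in> V"
  then obtain p where p: "edge_path V E p" "hd p = x" "last p = y"
      "graph_dist V E x y = real (length p - 1)"
    by (rule shortest_path)
  have "p \<noteq> []"
    using p by (simp add: edge_path_def)
  then have len: "i < length p" if "i \<le> length p - 1" for i
    using that by (cases p) auto
  show "\<exists>c n. c 0 = x \<and> c n = y \<and> (\<forall>i\<le>n. c i \<in> V) \<and>
      (\<forall>i\<le>n. \<forall>j\<le>n. graph_dist V E (c i) (c j) = \<bar>real i - real j\<bar>)"
  proof (intro exI conjI allI impI)
    show "p ! 0 = x" "p ! (length p - 1) = y"
      using p \<open>p \<noteq> []\<close> by (auto simp: hd_conv_nth last_conv_nth)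
    show "p ! i \<in> V" if "i \<le> length p - 1" for i
      using p len[OF that] by (auto simp: edge_path_def)
    show "graph_dist V E (p ! i) (p ! j) = \<bar>real i - real j\<bar>"
      if "i \<le> length p - 1" "j \<le> length p - 1" for i j
      using p len that by (intro shortest_path_geodesic) auto
  qed
qed

end

locale bounded_degree_graph = connected_graph V E for V :: "'a set" and E +
  fixes D :: nat
  assumes finite_neighbours: "x \<in> V \<Longrightarrow> finite {y \<in> V. {x, y} \<in> E}"
    and card_neighbours: "x \<in> V \<Longrightarrow> card {y \<in> V. {x, y} \<in> E} \<le> D"
begin

definition paths_from :: "'a \<Rightarrow> nat \<Rightarrow> 'a list set" where
  "paths_from x n = {p. edge_path V E p \<and> hd p = x \<and> length p = Suc n}"

lemma paths_from_Suc:
  "paths_from x (Suc n) = (\<Union>p\<in>paths_from x n. (\<lambda>y. p @ [y]) ` {y \<in> V. {last p, y} \<in> E})"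
proof (intro subset_antisym subsetI)
  fix q
  assume q: "q \<in> paths_from x (Suc n)"
  then obtain p y where py: "q = p @ [y]" "length p = Suc n"
    by (cases q rule: rev_cases) (auto simp: paths_from_def)
  then have "p \<noteq> []"
    by auto
  then show "q \<in> (\<Union>p\<in>paths_from x n. (\<lambda>y. p @ [y]) ` {y \<in> V. {last p, y} \<in> E})"
    using q py by (auto simp: paths_from_def edge_path_def successively_append_iff)
next
  fix q
  assume "q \<in> (\<Union>p\<in>paths_from x n. (\<lambda>y. p @ [y]) ` {y \<in> V. {last p, y} \<in> E})"
  then show "q \<in> paths_from x (Suc n)"
    by (auto simp: paths_from_def edge_path_def successively_append_iff)
qed

lemma paths_from_bound: "finite (paths_from x n) \<and> card (paths_from x n) \<le> D ^ n"
proof (induction n)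
  case 0
  have "paths_from x 0 \<subseteq> {[x]}"
    by (auto simp: paths_from_def length_Suc_conv)
  then show ?case
    using card_mono[of "{[x]}" "paths_from x 0"] finite_subset by auto
next
  case (Suc n)
  let ?N = "\<lambda>p. (\<lambda>y. p @ [y]) ` {y \<in> V. {last p, y} \<in> E}"
  have N: "finite (?N p) \<and> card (?N p) \<le> D" if "p \<in> paths_from x n" for p
  proof -
    have "last p \<in> V"
      using that by (auto simp: paths_from_def edge_path_def)
    then show ?thesis
      using finite_neighbours card_neighbours card_image_le order_trans by blast
  qed
  have "card (paths_from x (Suc n)) \<le> (\<Sum>p\<in>paths_from x n. card (?N p))"
    unfolding paths_from_Suc using Suc by (intro card_UN_le) auto
  also have "\<dots> \<le> of_nat (card (paths_from x n)) * D"
    using N by (intro sum_bounded_above) auto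
  also have "\<dots> \<le> D ^ n * D"
    using Suc by (intro mult_right_mono) auto
  finally show ?case
    using Suc N by (simp add: paths_from_Suc mult.commute)
qed

end


section \<open>Cayley graphs\<close>

locale cayley_graph = group G for G (structure) +
  fixes S :: "'a set"
  assumes generators: "finite_symmetric_generating_set G S"
begin

lemma finite_S: "finite S" and S_carrier: "S \<subseteq> carrier G"
  and S_inv: "s \<in> S \<Longrightarrow> inv s \<in> S" and S_generates: "generate G S = carrier G"
  using generators by (auto simp: finite_symmetric_generating_set_def)

lemma cayley_edge_iff:
  assumes "g \<in> carrier G" "h \<in> carrier G"
  shows "{g, h} \<in> cayley_edges G S \<longleftrightarrow> inv g \<otimes> h \<in> S"
proof
  assume "{g, h} \<in> cayley_edges G S"
  then consider "inv g \<otimes> h \<in> S" | "inv h \<otimes> g \<in> S"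
    by (auto simp: cayley_edges_def doubleton_eq_iff)
  then show "inv g \<otimes> h \<in> S"
  proof cases
    case 2
    then have "inv (inv h \<otimes> g) \<in> S"
      by (rule S_inv)
    then show ?thesis
      using assms by (simp add: inv_mult_group)
  qed
qed (use assms in \<open>auto simp: cayley_edges_def\<close>)

lemma connected_to_product:
  assumes "h \<in> generate G S" "g \<in> carrier G"
  shows "\<exists>p. edge_path (carrier G) (cayley_edges G S) p \<and> hd p = g \<and> last p = g \<otimes> h"
proof -
  have step: "\<exists>p. edge_path (carrier G) (cayley_edges G S) p \<and> hd p = g \<and> last p = g \<otimes> s"
    if "s \<in> S" "g \<in> carrier G" for s g
    using that S_carrier cayley_edge_iff[of g "g \<otimes> s"]
    by (intro exI[of _ "[g, g \<otimes> s]"]) (auto simp: edge_path_def subset_iff simp flip: m_assoc)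
  show ?thesis
    using assms
  proof (induction arbitrary: g rule: generate.induct)
    case one
    then show ?case
      by (intro exI[of _ "[g]"]) (simp add: edge_path_def)
  next
    case (incl h)
    then show ?case
      by (rule step)
  next
    case (inv h)
    then show ?case
      by (intro step S_inv)
  next
    case (eng h1 h2)
    then have h: "h1 \<in> carrier G" "h2 \<in> carrier G"
      using S_generates by auto
    obtain p where p: "edge_path (carrier G) (cayley_edges G S) p" "hd p = g" "last p = g \<otimes> h1"
      using eng by blast
    obtain q where q: "edge_path (carrier G) (cayley_edges G S) q" "hd q = g \<otimes> h1"
        "last q = g \<otimes> h1 \<otimes> h2"
      using eng h by (meson m_closed)
    then show ?case
      using edge_path_append[of _ _ p q] p h eng.prems
      by (intro exI[of _ "p @ tl q"]) (auto simp: m_assoc)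
  qed
qed

lemma neighbours_subset:
  "g \<in> carrier G \<Longrightarrow> {h \<in> carrier G. {g, h} \<in> cayley_edges G S} \<subseteq> (\<lambda>s. g \<otimes> s) ` S"
proof
  fix h
  assume g: "g \<in> carrier G" and h: "h \<in> {h \<in> carrier G. {g, h} \<in> cayley_edges G S}"
  then have "inv g \<otimes> h \<in> S" "h = g \<otimes> (inv g \<otimes> h)"
    by (auto simp: cayley_edge_iff simp flip: m_assoc)
  then show "h \<in> (\<lambda>s. g \<otimes> s) ` S"
    by blast
qed

sublocale bounded_degree_graph "carrier G" "cayley_edges G S" "card S"
proof
  show "\<exists>p. edge_path (carrier G) (cayley_edges G S) p \<and> hd p = x \<and> last p = y"
    if "x \<in> carrier G" "y \<in> carrier G" for x y
  proof -
    have "x \<otimes> (inv x \<otimes> y) = y"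
      using that by (simp flip: m_assoc)
    then show ?thesis
      using connected_to_product[of "inv x \<otimes> y" x] that S_generates by simp
  qed
  show "finite {y \<in> carrier G. {x, y} \<in> cayley_edges G S}"
    "card {y \<in> carrier G. {x, y} \<in> cayley_edges G S} \<le> card S" if "x \<in> carrier G" for x
    using neighbours_subset[OF that] finite_S
    by (auto intro: finite_subset order_trans[OF card_mono card_image_le])
qed

lemma cayley_dist_translate:
  assumes "g \<in> carrier G" "x \<in> carrier G" "y \<in> carrier G"
  shows "cayley_dist G S (g \<otimes> x) (g \<otimes> y) \<le> cayley_dist G S x y"
proof -
  obtain p where p: "edge_path (carrier G) (cayley_edges G S) p" "hd p = x" "last p = y"
      "cayley_dist G S x y = real (length p - 1)"
    using shortest_path[OF assms(2,3)] by (metis cayley_dist_def)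
  have "{g \<otimes> a, g \<otimes> b} \<in> cayley_edges G S"
    if "a \<in> carrier G" "b \<in> carrier G" "{a, b} \<in> cayley_edges G S" for a b
  proof -
    have "inv g \<otimes> (g \<otimes> b) = b"
      using that assms(1) by (simp flip: m_assoc)
    then have "inv (g \<otimes> a) \<otimes> (g \<otimes> b) = inv a \<otimes> b"
      using that assms(1) by (simp add: inv_mult_group m_assoc)
    then show ?thesis
      using that assms(1) by (simp add: cayley_edge_iff)
  qed
  then have "edge_path (carrier G) (cayley_edges G S) (map ((\<otimes>) g) p)"
    using p(1) assms(1)
    by (auto simp: edge_path_def successively_map subset_iff intro: successively_mono)
  then show ?thesis
    using graph_dist_le[of "carrier G" "cayley_edges G S" "map ((\<otimes>) g) p"] p
    by (simp add: cayley_dist_def edge_path_def hd_map last_map)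
qed

text \<open>
  Word metrics for finite generating sets are bi-Lipschitz equivalent: by invariance under
  translations, a step of the second graph is as long as one of finitely many generators.
\<close>

lemma cayley_dist_le_mult:
  assumes "finite_symmetric_generating_set G T"
  shows "\<exists>L\<ge>1. \<forall>x\<in>carrier G. \<forall>y\<in>carrier G. cayley_dist G S x y \<le> L * cayley_dist G T x y"
proof -
  interpret T: cayley_graph G T
    by unfold_locales (rule assms)
  define L where "L = 1 + (\<Sum>t\<in>T. cayley_dist G S \<one> t)"
  have nonneg: "0 \<le> cayley_dist G S \<one> t" if "t \<in> T" for t
    unfolding cayley_dist_def using that T.S_carrier by (intro dist_nonneg) auto
  have edge: "cayley_dist G S a b \<le> L"
    if ab: "a \<in> carrier G" "b \<in> carrier G" "{a, b} \<in> cayley_edges G T" for a b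
  proof -
    define t where "t = inv a \<otimes> b"
    have t: "t \<in> T" "a \<otimes> t = b" "t \<in> carrier G"
      using ab T.cayley_edge_iff[of a b] by (auto simp: t_def simp flip: m_assoc)
    have "cayley_dist G S a b \<le> cayley_dist G S \<one> t"
      using cayley_dist_translate[of a \<one> t] ab t by simp
    also have "\<dots> \<le> (\<Sum>t\<in>T. cayley_dist G S \<one> t)"
      using T.finite_S t nonneg by (intro member_le_sum) auto
    finally show ?thesis
      by (simp add: L_def)
  qed
  have path: "cayley_dist G S (hd p) (last p) \<le> L * real (length p - 1)"
    if "edge_path (carrier G) (cayley_edges G T) p" for p
    using that
  proof (induction p rule: induct_list012)
    case (2 x)
    then show ?case
      using dist_self[of x] by (simp add: edge_path_def cayley_dist_def)
  next
    case (3 x y p)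
    then have V: "x \<in> carrier G" "y \<in> carrier G" "last (y # p) \<in> carrier G"
        "{x, y} \<in> cayley_edges G T"
      using last_in_set[of "y # p"] by (auto simp: edge_path_def simp del: last.simps)
    have "cayley_dist G S y (last (y # p)) \<le> L * real (length (y # p) - 1)"
      using 3 by (simp add: edge_path_def)
    then show ?case
      using edge[OF V(1,2,4)] dist_triangle[OF V(1-3)]
      by (simp add: cayley_dist_def algebra_simps)
  qed (simp add: edge_path_def)
  have "cayley_dist G S x y \<le> L * cayley_dist G T x y"
    if xy: "x \<in> carrier G" "y \<in> carrier G" for x y
  proof -
    obtain p where "edge_path (carrier G) (cayley_edges G T) p" "hd p = x" "last p = y"
        "cayley_dist G T x y = real (length p - 1)"
      using T.shortest_path[OF xy] by (metis cayley_dist_def)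
    then show ?thesis
      using path[of p] by simp
  qed
  moreover have "1 \<le> L"
    unfolding L_def using nonneg by (simp add: sum_nonneg)
  ultimately show ?thesis
    by blast
qed

end

lemma hyperbolic_space_if_gromov_hyperbolic:
  assumes "pseudometric_on V d" "gromov_hyperbolic V d"
  shows "\<exists>\<delta>. hyperbolic_space V d \<delta>"
proof -
  interpret pseudometric_on V d
    by fact
  obtain \<delta> where \<delta>: "\<forall>w\<in>V. \<forall>x\<in>V. \<forall>y\<in>V. \<forall>z\<in>V.
      min (gromov_product d w x y) (gromov_product d w y z) - \<delta> \<le> gromov_product d w x z"
    using assms(2) unfolding gromov_hyperbolic_def by blast
  have "hyperbolic_space V d (max \<delta> 1)"
  proof
    fix w x y z
    assume "w \<in> V" "x \<in> V" "y \<in> V" "z \<in> V"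
    then have "min (gromov_product d w x y) (gromov_product d w y z) - \<delta> \<le> gromov_product d w x z"
      using \<delta> by blast
    then show "min (gromov_product d w x y) (gromov_product d w y z) - max \<delta> 1
        \<le> gromov_product d w x z"
      by linarith
  qed simp
  then show ?thesis ..
qed

lemma hyperbolic_group_word_metric:
  assumes "hyperbolic_group G" "finite_symmetric_generating_set G S"
  shows "\<exists>\<delta>. hyperbolic_space (carrier G) (cayley_dist G S) \<delta>"
proof -
  obtain T where G: "group G" and T: "finite_symmetric_generating_set G T"
      "gromov_hyperbolic (carrier G) (cayley_dist G T)"
    using assms(1) by (auto simp: hyperbolic_group_def)
  interpret S: cayley_graph G S
    by (simp add: cayley_graph_def cayley_graph_axioms_def G assms(2))
  interpret T: cayley_graph G T
    by (simp add: cayley_graph_def cayley_graph_axioms_def G T)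
  have pm: "pseudometric_on (carrier G) (cayley_dist G S)" "pseudometric_on (carrier G) (cayley_dist G T)"
    unfolding cayley_dist_def by (rule S.pseudometric_graph_dist T.pseudometric_graph_dist)+
  obtain \<delta> where "hyperbolic_space (carrier G) (cayley_dist G T) \<delta>"
    using hyperbolic_space_if_gromov_hyperbolic pm(2) T(2) by blast
  then interpret hyperbolic_space "carrier G" "cayley_dist G T" \<delta> .
  obtain L1 where L1: "1 \<le> L1" "\<And>x y. x \<in> carrier G \<Longrightarrow> y \<in> carrier G \<Longrightarrow>
      cayley_dist G S x y \<le> L1 * cayley_dist G T x y"
    using S.cayley_dist_le_mult[OF T(1)] by blast
  obtain L2 where L2: "1 \<le> L2" "\<And>x y. x \<in> carrier G \<Longrightarrow> y \<in> carrier G \<Longrightarrow>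
      cayley_dist G T x y \<le> L2 * cayley_dist G S x y"
    using T.cayley_dist_le_mult[OF assms(2)] by blast
  have "gromov_hyperbolic (carrier G) (cayley_dist G S)"
  proof (rule bilipschitz_geodesic_hyperbolic[where L = "max L1 L2"])
    show "discretely_geodesic (carrier G) (cayley_dist G S)"
      unfolding cayley_dist_def by (rule S.discretely_geodesic_graph_dist)
    show "cayley_dist G T x y \<le> max L1 L2 * cayley_dist G S x y"
      if xy: "x \<in> carrier G" "y \<in> carrier G" for x y
      using L2(2)[OF xy] pseudometric_on.dist_nonneg[OF pm(1) xy]
        mult_right_mono[of L2 "max L1 L2" "cayley_dist G S x y"] by linarith
    show "cayley_dist G S x y \<le> max L1 L2 * cayley_dist G T x y"
      if xy: "x \<in> carrier G" "y \<in> carrier G" for x y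
      using L1(2)[OF xy] pseudometric_on.dist_nonneg[OF pm(2) xy]
        mult_right_mono[of L1 "max L1 L2" "cayley_dist G T x y"] by linarith
  qed (use pm L1 in auto)
  then show ?thesis
    using hyperbolic_space_if_gromov_hyperbolic pm(1) by blast
qed


section \<open>The law of the passage times\<close>

locale passage_times =
  fixes \<rho> :: "real measure"
  assumes law: "passage_time_law \<rho>"
begin

abbreviation weight_law :: "real measure" where
  "weight_law \<equiv> restrict_space \<rho> {0..}"

lemma prob_\<rho>: "prob_space \<rho>" and sets_\<rho>: "sets \<rho> = sets borel"
  and no_atom: "emeasure \<rho> {x} = 0"
  using law by (auto simp: passage_time_law_def)

lemma measurable_\<rho>: "f \<in> borel_measurable borel \<Longrightarrow> f \<in> borel_measurable \<rho>"
  by (subst measurable_cong_sets[OF sets_\<rho> refl])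

text \<open>The complement of the support is a null set, because open covers in \<open>\<real>\<close> have countable subcovers.\<close>

lemma AE_nonneg: "AE x in \<rho>. 0 \<le> x"
proof -
  define F where "F = {U. open U \<and> emeasure \<rho> U = 0}"
  obtain F' where F': "F' \<subseteq> F" "countable F'" "\<Union> F' = \<Union> F"
    using Lindelof[of F] by (auto simp: F_def)
  have "(\<Union>U\<in>F'. U) \<in> null_sets \<rho>"
    using F' sets_\<rho> by (intro null_sets_UN') (auto simp: F_def null_sets_def)
  moreover have "{x. x < 0} \<subseteq> \<Union> F"
  proof
    fix x :: real
    assume "x \<in> {x. x < 0}"
    moreover have "measure_support \<rho> \<subseteq> {0..}"
      using law by (simp add: passage_time_law_def)
    ultimately have "x \<notin> measure_support \<rho>"
      by auto
    then show "x \<in> \<Union> F"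
      by (auto simp: measure_support_def F_def)
  qed
  ultimately show ?thesis
    using F'(3) by (intro AE_I'[of "\<Union> F'"]) (auto simp: not_le)
qed

lemma prob_weight_law: "prob_space weight_law"
proof (rule prob_space_restrict_space)
  interpret prob_space \<rho>
    by (rule prob_\<rho>)
  show "{0..} \<in> sets \<rho>"
    by (simp add: sets_\<rho>)
  then show "emeasure \<rho> {0..} = 1"
    using AE_nonneg by (subst emeasure_eq_1_AE) auto
qed

lemma measurable_weight_law: "f \<in> borel_measurable borel \<Longrightarrow> f \<in> borel_measurable weight_law"
  by (intro measurable_restrict_space1 measurable_\<rho>)

lemma AE_weight_pos: "AE x in weight_law. 0 < x"
proof -
  have "AE x in \<rho>. x \<noteq> 0"
    using no_atom[of 0] sets_\<rho> by (intro AE_I[of _ _ "{0}"]) auto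
  then have "AE x in \<rho>. 0 \<le> x \<longrightarrow> 0 < x"
    by eventually_elim auto
  then show ?thesis
    using sets_\<rho> by (subst AE_restrict_space_iff) auto
qed

text \<open>Since \<open>0\<close> is not an atom, the Laplace transform vanishes at infinity.\<close>

lemma laplace_transform_small:
  assumes "0 < q"
  shows "\<exists>t>0. (\<integral>\<^sup>+ x. ennreal (exp (- (t * x))) \<partial>weight_law) \<le> ennreal q"
proof -
  interpret prob_space weight_law
    by (rule prob_weight_law)
  have nonneg: "0 \<le> x" if "x \<in> space weight_law" for x
    using that by (simp add: space_restrict_space)
  have meas: "(\<lambda>x. exp (- (real k * x))) \<in> borel_measurable weight_law" for k
    by (intro measurable_weight_law) simp
  have "(\<lambda>k. \<integral>x. exp (- (real k * x)) \<partial>weight_law) \<longlonglongrightarrow> (\<integral>x. 0 \<partial>weight_law)"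
  proof (rule integral_dominated_convergence[where w = "\<lambda>_. 1"])
    show "AE x in weight_law. (\<lambda>k. exp (- (real k * x))) \<longlonglongrightarrow> 0"
      using AE_weight_pos
    proof eventually_elim
      case (elim x)
      have "(\<lambda>k. exp (- x) ^ k) \<longlonglongrightarrow> 0"
        using elim by (intro LIMSEQ_realpow_zero) auto
      then show ?case
        by (simp flip: exp_of_nat_mult)
    qed
    show "AE x in weight_law. norm (exp (- (real k * x))) \<le> 1" for k
      using nonneg by (intro AE_I2) simp
  qed (use meas in auto)
  then have "(\<lambda>k. \<integral>x. exp (- (real k * x)) \<partial>weight_law) \<longlonglongrightarrow> 0"
    by simp
  from order_tendstoD(2)[OF this assms]
  obtain N where N: "\<And>k. k \<ge> N \<Longrightarrow> (\<integral>x. exp (- (real k * x)) \<partial>weight_law) < q"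
    by (auto simp: eventually_sequentially)
  define k where "k = Suc N"
  have "integrable weight_law (\<lambda>x. exp (- (real k * x)))"
    using meas nonneg by (intro integrable_const_bound[where B = 1] AE_I2) auto
  then have "(\<integral>\<^sup>+ x. ennreal (exp (- (real k * x))) \<partial>weight_law)
      = ennreal (\<integral>x. exp (- (real k * x)) \<partial>weight_law)"
    by (intro nn_integral_eq_integral) auto
  also have "\<dots> \<le> ennreal q"
    using N[of k] by (intro ennreal_leI) (simp add: k_def)
  finally show ?thesis
    by (intro exI[of _ "real k"]) (simp add: k_def)
qed

lemma gaussian_moment:
  "\<exists>a>0. \<exists>c\<ge>0. (\<integral>\<^sup>+ x. ennreal (exp (a * x\<^sup>2)) \<partial>weight_law) \<le> ennreal c"
proof -
  obtain a where a: "0 < a" "(\<integral>\<^sup>+ x. ennreal (exp (a * x\<^sup>2)) \<partial>\<rho>) < \<infinity>"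
    using law by (auto simp: passage_time_law_def)
  have "(\<integral>\<^sup>+ x. ennreal (exp (a * x\<^sup>2)) \<partial>weight_law)
      = (\<integral>\<^sup>+ x. ennreal (exp (a * x\<^sup>2)) * indicator {0..} x \<partial>\<rho>)"
    using sets_\<rho> by (intro nn_integral_restrict_space) auto
  also have "\<dots> \<le> (\<integral>\<^sup>+ x. ennreal (exp (a * x\<^sup>2)) \<partial>\<rho>)"
    by (intro nn_integral_mono) (auto simp: indicator_def)
  finally show ?thesis
    using a by (intro exI[of _ a] conjI exI[of _ "enn2real (\<integral>\<^sup>+ x. ennreal (exp (a * x\<^sup>2)) \<partial>\<rho>)"])
      (auto simp: less_top)
qed

lemma measurable_weight:
  assumes "e \<in> E"
  shows "(\<lambda>\<omega>. \<omega> e) \<in> borel_measurable (passage_time_space E \<rho>)"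
proof -
  have "(\<lambda>x. x) \<in> borel_measurable weight_law"
    by (intro measurable_weight_law) simp
  from measurable_compose[OF measurable_component_singleton[OF assms, of "\<lambda>_. weight_law"] this]
  show ?thesis
    by (simp add: passage_time_space_def)
qed

lemma weight_nonneg: "\<omega> \<in> space (passage_time_space E \<rho>) \<Longrightarrow> e \<in> E \<Longrightarrow> 0 \<le> \<omega> e"
  by (auto simp: passage_time_space_def space_PiM space_restrict_space PiE_iff)

lemma nn_integral_prod_weights:
  assumes J: "finite J" "J \<subseteq> E" and f: "f \<in> borel_measurable borel"
  shows "(\<integral>\<^sup>+ \<omega>. (\<Prod>e\<in>J. f (\<omega> e)) \<partial>passage_time_space E \<rho>) = (\<integral>\<^sup>+ x. f x \<partial>weight_law) ^ card J"
proof -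
  interpret weight_law: prob_space weight_law
    by (rule prob_weight_law)
  interpret product_prob_space "\<lambda>_. weight_law" E
    by unfold_locales
  have f': "f \<in> borel_measurable weight_law"
    by (intro measurable_weight_law f)
  have "(\<integral>\<^sup>+ \<omega>. (\<Prod>e\<in>J. f (\<omega> e)) \<partial>Pi\<^sub>M E (\<lambda>_. weight_law))
      = (\<integral>\<^sup>+ \<omega>. (\<Prod>e\<in>J. f (restrict \<omega> J e)) \<partial>Pi\<^sub>M E (\<lambda>_. weight_law))"
    by simp
  also have "\<dots> = (\<integral>\<^sup>+ \<omega>. (\<Prod>e\<in>J. f (\<omega> e))
      \<partial>distr (Pi\<^sub>M E (\<lambda>_. weight_law)) (Pi\<^sub>M J (\<lambda>_. weight_law)) (\<lambda>\<omega>. restrict \<omega> J))"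
    using J f' by (subst nn_integral_distr) (auto intro!: measurable_restrict_subset
      borel_measurable_prod_ennreal measurable_compose[OF measurable_component_singleton])
  also have "\<dots> = (\<integral>\<^sup>+ \<omega>. (\<Prod>e\<in>J. f (\<omega> e)) \<partial>Pi\<^sub>M J (\<lambda>_. weight_law))"
    using J by (subst distr_PiM_restrict_finite) auto
  also have "\<dots> = (\<integral>\<^sup>+ x. f x \<partial>weight_law) ^ card J"
    using J f' by (subst product_nn_integral_prod) auto
  finally show ?thesis
    by (simp add: passage_time_space_def)
qed

end


section \<open>Geodesic rays escape at a polynomial rate\<close>

locale first_passage_percolation = bounded_degree_graph V E D + passage_times \<rho>
  for V :: "'a set" and E D \<rho>
begin

abbreviation "\<Omega> \<equiv> passage_time_space E \<rho>"

text \<open>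
  A rate of decay per edge that makes up for the number of paths: as \<open>D * decay\<close> is at most
  \<open>1 / 2\<close>, quantities of size \<open>decay\<^sup>n\<close> can be summed over all paths. The \<open>+ 1\<close> covers \<open>D = 0\<close>.
\<close>

definition decay :: real where "decay = 1 / (2 * real (D + 1))"

lemma decay: "0 < decay" "decay < 1" "real D * decay \<le> 1 / 2"
  by (auto simp: decay_def field_simps)

text \<open>
  The first moment method: as there are at most \<open>D\<^sup>n\<close> paths with \<open>n\<close> edges starting at
  \<open>x\<close>, the sum of all \<open>g n p\<close> has finite expectation.
\<close>

lemma AE_bounded_along_paths:
  assumes A: "\<And>n. A n \<subseteq> paths_from x n"
    and meas: "\<And>n p. p \<in> A n \<Longrightarrow> g n p \<in> borel_measurable \<Omega>"
    and c: "0 \<le> c"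
    and mean: "\<And>n p. p \<in> A n \<Longrightarrow> (\<integral>\<^sup>+ \<omega>. ennreal (g n p \<omega>) \<partial>\<Omega>) \<le> ennreal (c * decay ^ n)"
  shows "AE \<omega> in \<Omega>. \<exists>B\<ge>1. \<forall>n. \<forall>p\<in>A n. g n p \<omega> \<le> B"
proof -
  define F where "F \<omega> = (\<Sum>n. \<Sum>p\<in>A n. ennreal (g n p \<omega>))" for \<omega>
  have fin: "finite (A n)" and card: "card (A n) \<le> D ^ n" for n
    using paths_from_bound[of x n] A[of n] card_mono[of "paths_from x n" "A n"]
    by (auto intro: finite_subset)
  have meas_F: "F \<in> borel_measurable \<Omega>"
    unfolding F_def using meas by (intro borel_measurable_suminf_order borel_measurable_sum) auto
  have "(\<integral>\<^sup>+ \<omega>. F \<omega> \<partial>\<Omega>) = (\<Sum>n. \<integral>\<^sup>+ \<omega>. (\<Sum>p\<in>A n. ennreal (g n p \<omega>)) \<partial>\<Omega>)"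
    unfolding F_def using meas by (intro nn_integral_suminf borel_measurable_sum) auto
  also have "\<dots> \<le> (\<Sum>n. ennreal (c * (1 / 2) ^ n))"
  proof (intro suminf_le)
    fix n
    have "(\<integral>\<^sup>+ \<omega>. (\<Sum>p\<in>A n. ennreal (g n p \<omega>)) \<partial>\<Omega>) = (\<Sum>p\<in>A n. \<integral>\<^sup>+ \<omega>. ennreal (g n p \<omega>) \<partial>\<Omega>)"
      using meas by (intro nn_integral_sum) auto
    also have "\<dots> \<le> (\<Sum>p\<in>A n. ennreal (c * decay ^ n))"
      using mean by (intro sum_mono) auto
    also have "\<dots> = ennreal (real (card (A n)) * (c * decay ^ n))"
      using c decay by (simp add: ennreal_mult ennreal_of_nat_eq_real_of_nat)
    also have "\<dots> \<le> ennreal (c * (1 / 2) ^ n)"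
    proof (intro ennreal_leI)
      have "real (card (A n)) * (c * decay ^ n) \<le> real (D ^ n) * (c * decay ^ n)"
        using card[of n] c decay by (intro mult_right_mono) (auto simp flip: of_nat_power)
      also have "\<dots> = c * (real D * decay) ^ n"
        by (simp add: power_mult_distrib)
      also have "\<dots> \<le> c * (1 / 2) ^ n"
        using c decay by (intro mult_left_mono power_mono) auto
      finally show "real (card (A n)) * (c * decay ^ n) \<le> c * (1 / 2) ^ n" .
    qed
    finally show "(\<integral>\<^sup>+ \<omega>. (\<Sum>p\<in>A n. ennreal (g n p \<omega>)) \<partial>\<Omega>) \<le> ennreal (c * (1 / 2) ^ n)" .
  qed auto
  also have "\<dots> < \<infinity>"
  proof -
    have "summable (\<lambda>n. c * (1 / 2 :: real) ^ n)"
      by (intro summable_mult summable_geometric) simp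
    then show ?thesis
      using c by (subst suminf_ennreal2) auto
  qed
  finally have "AE \<omega> in \<Omega>. F \<omega> \<noteq> \<infinity>"
    using meas_F by (intro nn_integral_PInf_AE) auto
  then show ?thesis
  proof eventually_elim
    case (elim \<omega>)
    have "g n p \<omega> \<le> max 1 (enn2real (F \<omega>))" if "p \<in> A n" for n p
    proof -
      have "ennreal (g n p \<omega>) \<le> (\<Sum>p\<in>A n. ennreal (g n p \<omega>))"
        using fin that by (intro member_le_sum) auto
      also have "\<dots> = (\<Sum>n\<in>{n}. \<Sum>p\<in>A n. ennreal (g n p \<omega>))"
        by simp
      also have "\<dots> \<le> F \<omega>"
        unfolding F_def by (intro sum_le_suminf) auto
      also have "\<dots> = ennreal (enn2real (F \<omega>))"
        using elim by (simp add: less_top)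
      finally show ?thesis
        by (simp add: le_max_iff_disj)
    qed
    then show ?case
      by (intro exI[of _ "max 1 (enn2real (F \<omega>))"]) auto
  qed
qed

lemma path_edge_in:
  "p \<in> paths_from x n \<Longrightarrow> i < n \<Longrightarrow> {p ! i, p ! Suc i} \<in> E"
  by (auto simp: paths_from_def intro: edge_path_nth)

lemma path_edges_inj:
  assumes "distinct p" "length p = Suc n"
  shows "inj_on (\<lambda>i. {p ! i, p ! Suc i}) {..<n}"
proof (rule inj_onI)
  fix i j
  assume "i \<in> {..<n}" "j \<in> {..<n}" "{p ! i, p ! Suc i} = {p ! j, p ! Suc j}"
  then show "i = j"
    using assms by (auto simp: doubleton_eq_iff nth_eq_iff_index_eq)
qed

lemma measurable_path_length:
  assumes "p \<in> paths_from x n"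
  shows "(\<lambda>\<omega>. path_length \<omega> p) \<in> borel_measurable \<Omega>"
  unfolding path_length_def
  using assms path_edge_in[OF assms]
  by (intro borel_measurable_sum measurable_weight) (simp add: paths_from_def)

text \<open>
  Self-avoiding paths are long in the random metric: their edges are distinct, so that the
  Laplace transform of the passage time is a power, and it beats the number of paths.
\<close>

lemma AE_self_avoiding_paths_long:
  "\<exists>t>0. AE \<omega> in \<Omega>. \<exists>B\<ge>1. \<forall>n. \<forall>p\<in>paths_from x n. distinct p \<longrightarrow>
     2 ^ n * exp (- (t * path_length \<omega> p)) \<le> B"
proof -
  obtain t where t: "0 < t"
    and small: "(\<integral>\<^sup>+ x. ennreal (exp (- (t * x))) \<partial>weight_law) \<le> ennreal (decay / 2)"
    using laplace_transform_small[of "decay / 2"] decay by auto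
  have "AE \<omega> in \<Omega>. \<exists>B\<ge>1. \<forall>n. \<forall>p\<in>{p \<in> paths_from x n. distinct p}.
      2 ^ n * exp (- (t * path_length \<omega> p)) \<le> B"
  proof (rule AE_bounded_along_paths[where c = 1])
    fix n p
    assume "p \<in> {p \<in> paths_from x n. distinct p}"
    then have p: "p \<in> paths_from x n" "distinct p" "length p = Suc n"
      by (auto simp: paths_from_def)
    show "(\<lambda>\<omega>. 2 ^ n * exp (- (t * path_length \<omega> p))) \<in> borel_measurable \<Omega>"
      using measurable_path_length[OF p(1)] by measurable
    define J where "J = (\<lambda>i. {p ! i, p ! Suc i}) ` {..<n}"
    have J: "finite J" "J \<subseteq> E" "card J = n"
      using path_edges_inj[OF p(2,3)] path_edge_in[OF p(1)] by (auto simp: J_def card_image)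
    have "path_length \<omega> p = (\<Sum>e\<in>J. \<omega> e)" for \<omega>
      unfolding J_def path_length_def using path_edges_inj[OF p(2,3)] p(3)
      by (simp add: sum.reindex)
    then have "exp (- (t * path_length \<omega> p)) = (\<Prod>e\<in>J. exp (- (t * \<omega> e)))" for \<omega>
      using J(1) by (simp add: sum_distrib_left exp_sum flip: sum_negf)
    then have "ennreal (2 ^ n * exp (- (t * path_length \<omega> p)))
        = ennreal (2 ^ n) * (\<Prod>e\<in>J. ennreal (exp (- (t * \<omega> e))))" for \<omega>
      by (simp add: ennreal_mult prod_ennreal prod_nonneg)
    then have "(\<integral>\<^sup>+ \<omega>. ennreal (2 ^ n * exp (- (t * path_length \<omega> p))) \<partial>\<Omega>)
        = ennreal (2 ^ n) * (\<integral>\<^sup>+ \<omega>. (\<Prod>e\<in>J. ennreal (exp (- (t * \<omega> e)))) \<partial>\<Omega>)"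
    proof -
      have [measurable]: "(\<lambda>\<omega>. \<omega> e) \<in> borel_measurable \<Omega>" if "e \<in> J" for e
        using that J(2) by (intro measurable_weight) auto
      have "(\<lambda>\<omega>. \<Prod>e\<in>J. ennreal (exp (- (t * \<omega> e)))) \<in> borel_measurable \<Omega>"
        by (intro borel_measurable_prod_ennreal) measurable
      then show ?thesis
        unfolding \<open>\<And>\<omega>. ennreal (2 ^ n * exp (- (t * path_length \<omega> p))) = _\<close>
        by (rule nn_integral_cmult)
    qed
    also have "\<dots> = ennreal (2 ^ n) * (\<integral>\<^sup>+ x. ennreal (exp (- (t * x))) \<partial>weight_law) ^ n"
      using nn_integral_prod_weights[OF J(1,2), of "\<lambda>x. ennreal (exp (- (t * x)))"] J(3) by simp
    also have "\<dots> \<le> ennreal (2 ^ n) * ennreal (decay / 2) ^ n"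
      using small by (intro mult_left_mono power_mono) auto
    also have "\<dots> = ennreal (2 ^ n * (decay / 2) ^ n)"
      using decay by (simp add: ennreal_mult ennreal_power del: power_divide)
    also have "2 ^ n * (decay / 2) ^ n = 1 * decay ^ n"
      by (simp add: power_divide)
    finally show "(\<integral>\<^sup>+ \<omega>. ennreal (2 ^ n * exp (- (t * path_length \<omega> p))) \<partial>\<Omega>)
        \<le> ennreal (1 * decay ^ n)" .
  qed auto
  then show ?thesis
    using t by (intro exI[of _ t]) (simp add: Ball_def imp_conjL)
qed

text \<open>
  The Gaussian moment is turned into an almost sure bound by giving up a factor \<open>decay\<close> for every
  edge: the weight of the last edge is at most of the order of the square root of the number of
  edges.
\<close>

lemma AE_last_edge_short:
  "\<exists>a>0. AE \<omega> in \<Omega>. \<exists>B\<ge>1. \<forall>n. \<forall>p\<in>paths_from x (Suc n).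
     exp (a * (\<omega> {p ! n, p ! Suc n})\<^sup>2) * decay ^ Suc n \<le> B"
proof -
  obtain a c where a: "0 < a" and c: "0 \<le> c"
    and moment: "(\<integral>\<^sup>+ x. ennreal (exp (a * x\<^sup>2)) \<partial>weight_law) \<le> ennreal c"
    using gaussian_moment by auto
  have "AE \<omega> in \<Omega>. \<exists>B\<ge>1. \<forall>n. \<forall>p\<in>{p \<in> paths_from x n. 0 < n}.
      exp (a * (\<omega> {p ! (n - 1), p ! n})\<^sup>2) * decay ^ n \<le> B"
  proof (rule AE_bounded_along_paths[OF _ _ c])
    fix n p
    assume p: "p \<in> {p \<in> paths_from x n. 0 < n}"
    define e where "e = {p ! (n - 1), p ! n}"
    have e: "e \<in> E"
      using p path_edge_in[of p x n "n - 1"] by (simp add: e_def)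
    have [measurable]: "(\<lambda>\<omega>. \<omega> e) \<in> borel_measurable \<Omega>"
      using e by (rule measurable_weight)
    show "(\<lambda>\<omega>. exp (a * (\<omega> {p ! (n - 1), p ! n})\<^sup>2) * decay ^ n) \<in> borel_measurable \<Omega>"
      unfolding e_def[symmetric] by measurable
    have "(\<integral>\<^sup>+ \<omega>. ennreal (exp (a * (\<omega> e)\<^sup>2) * decay ^ n) \<partial>\<Omega>)
        = (\<integral>\<^sup>+ \<omega>. ennreal (exp (a * (\<omega> e)\<^sup>2)) \<partial>\<Omega>) * ennreal (decay ^ n)"
      using decay by (simp add: ennreal_mult nn_integral_multc)
    also have "(\<integral>\<^sup>+ \<omega>. ennreal (exp (a * (\<omega> e)\<^sup>2)) \<partial>\<Omega>) = (\<integral>\<^sup>+ x. ennreal (exp (a * x\<^sup>2)) \<partial>weight_law)"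
      using nn_integral_prod_weights[of "{e}" E "\<lambda>x. ennreal (exp (a * x\<^sup>2))"] e by simp
    also have "\<dots> * ennreal (decay ^ n) \<le> ennreal c * ennreal (decay ^ n)"
      using moment by (intro mult_right_mono) auto
    also have "\<dots> = ennreal (c * decay ^ n)"
      using c decay by (simp add: ennreal_mult)
    finally show "(\<integral>\<^sup>+ \<omega>. ennreal (exp (a * (\<omega> {p ! (n - 1), p ! n})\<^sup>2) * decay ^ n) \<partial>\<Omega>)
        \<le> ennreal (c * decay ^ n)"
      unfolding e_def[symmetric] .
  qed auto
  then have "AE \<omega> in \<Omega>. \<exists>B\<ge>1. \<forall>n. \<forall>p\<in>paths_from x (Suc n).
     exp (a * (\<omega> {p ! n, p ! Suc n})\<^sup>2) * decay ^ Suc n \<le> B"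
  proof eventually_elim
    case (elim \<omega>)
    then obtain B where B: "1 \<le> B" "\<And>n p. p \<in> paths_from x n \<Longrightarrow> 0 < n \<Longrightarrow>
        exp (a * (\<omega> {p ! (n - 1), p ! n})\<^sup>2) * decay ^ n \<le> B"
      by auto
    show ?case
      using B(1) B(2)[of _ "Suc _"] by (intro exI[of _ B]) simp
  qed
  then show ?thesis
    using a by blast
qed

lemma AE_last_edge_pos:
  "AE \<omega> in \<Omega>. \<forall>n. \<forall>p\<in>paths_from x (Suc n). 0 < \<omega> {p ! n, p ! Suc n}"
proof -
  have "AE \<omega> in \<Omega>. 0 < \<omega> {p ! n, p ! Suc n}" if "p \<in> paths_from x (Suc n)" for n p
    unfolding passage_time_space_def
    using path_edge_in[OF that, of n] prob_weight_law AE_weight_pos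
    by (intro AE_PiM_component) auto
  then show ?thesis
    using paths_from_bound
    by (subst AE_all_countable, intro allI, subst AE_ball_countable) (auto intro: countable_finite)
qed

text \<open>Between two visits to the same vertex, a geodesic would have passage time \<open>0\<close>.\<close>

lemma ray_self_avoiding:
  assumes nonneg: "\<And>e. e \<in> E \<Longrightarrow> 0 \<le> \<omega> e"
    and pos: "\<And>n p. p \<in> paths_from x (Suc n) \<Longrightarrow> 0 < \<omega> {p ! n, p ! Suc n}"
    and ray: "fpp_geodesic_ray V E \<omega> \<sigma>" "\<sigma> 0 = x"
  shows "inj \<sigma>"
proof (rule linorder_injI)
  fix i j :: nat
  assume "i < j"
  have geod: "fpp_geodesic V E \<omega> (map \<sigma> [m..<Suc n])" if "m \<le> n" for m n
    using ray that by (simp add: fpp_geodesic_ray_def del: upt_Suc)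
  show "\<sigma> i \<noteq> \<sigma> j"
  proof
    assume eq: "\<sigma> i = \<sigma> j"
    define p where "p = map \<sigma> [i..<Suc j]"
    have p: "edge_path V E p" "path_length \<omega> p = fpp_dist V E \<omega> (hd p) (last p)"
      using geod[of i j] \<open>i < j\<close> by (auto simp: p_def fpp_geodesic_def)
    have ends: "hd p = \<sigma> i" "last p = \<sigma> i" "length p = Suc (j - i)"
      using \<open>i < j\<close> eq by (auto simp: p_def hd_map last_map simp del: upt_Suc)
    have "\<sigma> i \<in> V"
      using p(1) ends hd_in_set[of p] by (auto simp: edge_path_def)
    then have "path_length \<omega> p \<le> 0"
      using fpp_dist_le[OF edge_path_single[of "\<sigma> i" V E], of \<omega>] nonneg p(2) ends by simp
    moreover have "\<omega> {p ! 0, p ! Suc 0} \<le> path_length \<omega> p"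
      unfolding path_length_def using \<open>i < j\<close> ends p(1) nonneg
      by (intro member_le_sum[where f = "\<lambda>i. \<omega> {p ! i, p ! Suc i}" and i = 0])
        (auto intro!: nonneg edge_path_nth)
    moreover have "0 < \<omega> {\<sigma> i, \<sigma> (Suc i)}"
    proof -
      have "map \<sigma> [0..<Suc (Suc i)] \<in> paths_from x (Suc i)"
        using geod[of 0 "Suc i"] ray(2) by (simp add: paths_from_def fpp_geodesic_def hd_map del: upt_Suc)
      from pos[OF this] show ?thesis
        by (simp del: upt_Suc)
    qed
    moreover have "p ! 0 = \<sigma> i" "p ! Suc 0 = \<sigma> (Suc i)"
      using \<open>i < j\<close> by (auto simp: p_def simp del: upt_Suc)
    ultimately show False
      by simp
  qed
qed

text \<open>
  The edges of a shortest path are last edges of its initial pieces. For their weights \<open>w\<close> the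
  linear bound obtained from \<open>w \<le> 1 + w\<^sup>2\<close> is good enough, because convergence at infinity
  only asks for a polynomial bound on the passage time.
\<close>

lemma dist_le_quadratic:
  assumes nonneg: "\<And>e. e \<in> E \<Longrightarrow> 0 \<le> \<omega> e"
    and a: "0 < a" and B: "1 \<le> B"
    and edge: "\<And>n p. p \<in> paths_from x (Suc n) \<Longrightarrow>
      exp (a * (\<omega> {p ! n, p ! Suc n})\<^sup>2) * decay ^ Suc n \<le> B"
    and xy: "x \<in> V" "y \<in> V"
  shows "fpp_dist V E \<omega> x y \<le> (1 + (ln B + ln (1 / decay)) / a) * (1 + graph_dist V E x y)\<^sup>2"
proof -
  obtain p where p: "edge_path V E p" "hd p = x" "last p = y"
      "graph_dist V E x y = real (length p - 1)"
    by (rule shortest_path[OF xy])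
  define n where "n = length p - 1"
  have "p \<noteq> []"
    using p by (simp add: edge_path_def)
  then have len: "length p = Suc n"
    by (simp add: n_def)
  define A where "A = 1 + (ln B + ln (1 / decay)) / a"
  have logs: "0 \<le> ln B" "0 \<le> ln (1 / decay)"
    using B decay by auto
  have "\<omega> {p ! i, p ! Suc i} \<le> A * (1 + real n)" if "i < n" for i
  proof -
    define w where "w = \<omega> {p ! i, p ! Suc i}"
    define q where "q = take (Suc (Suc i)) p"
    have "edge_path V E q"
      using p(1) set_take_subset[of "Suc (Suc i)" p]
        successively_append_iff[of "\<lambda>x y. {x, y} \<in> E" q "drop (Suc (Suc i)) p"]
      by (auto simp: edge_path_def q_def)
    then have "q \<in> paths_from x (Suc i)"
      using p(2) \<open>p \<noteq> []\<close> len that by (auto simp: paths_from_def q_def)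
    from edge[OF this] have "exp (a * w\<^sup>2) * decay ^ Suc i \<le> B"
      by (simp add: q_def w_def)
    then have "exp (a * w\<^sup>2) \<le> B * (1 / decay) ^ Suc i"
      using decay by (simp add: field_simps)
    then have "ln (exp (a * w\<^sup>2)) \<le> ln (B * (1 / decay) ^ Suc i)"
      using B decay by (intro ln_mono) auto
    also have "\<dots> = ln B + real (Suc i) * ln (1 / decay)"
      using B decay by (simp add: ln_mult ln_realpow del: power_Suc)
    also have "\<dots> \<le> ln B * (1 + real n) + ln (1 / decay) * (1 + real n)"
      using logs that mult_left_mono[of "real (Suc i)" "1 + real n" "ln (1 / decay)"]
        mult_left_mono[of 1 "1 + real n" "ln B"] by (simp add: mult.commute)
    finally have "w\<^sup>2 \<le> (ln B + ln (1 / decay)) / a * (1 + real n)"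
      using a by (simp add: field_simps)
    moreover have "w \<le> 1 + w\<^sup>2"
      using zero_le_power2[of "w - 1 / 2"] by (simp add: power2_eq_square algebra_simps)
    ultimately show ?thesis
      by (simp add: A_def w_def algebra_simps)
  qed
  then have "path_length \<omega> p \<le> real n * (A * (1 + real n))"
    unfolding path_length_def using len sum_bounded_above[of "{..<n}"
      "\<lambda>i. \<omega> {p ! i, p ! Suc i}" "A * (1 + real n)"] by simp
  also have "\<dots> \<le> (1 + real n) * (A * (1 + real n))"
    using logs a by (intro mult_right_mono) (auto simp: A_def)
  also have "\<dots> = A * (1 + graph_dist V E x y)\<^sup>2"
    using p(4) by (simp add: n_def power2_eq_square algebra_simps)
  finally show ?thesis
    using fpp_dist_le[OF p(1), of \<omega>] nonneg p(2,3) by (simp add: A_def)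
qed

text \<open>
  The first \<open>n\<close> steps of a geodesic ray form a self-avoiding path, whose passage time is at
  least linear in \<open>n\<close>; as the ray is geodesic, the passage time is at most quadratic
  in the graph distance that the ray has reached.
\<close>

theorem AE_geodesic_rays_escape:
  assumes x: "x \<in> V"
  shows "AE \<omega> in \<Omega>. \<forall>\<sigma>. fpp_geodesic_ray V E \<omega> \<sigma> \<and> \<sigma> 0 = x \<longrightarrow>
           (\<exists>B\<ge>0. \<forall>i. real i \<le> B * (1 + graph_dist V E x (\<sigma> i))\<^sup>2)"
proof -
  obtain t where t: "0 < t" and long: "AE \<omega> in \<Omega>. \<exists>B\<ge>1. \<forall>n. \<forall>p\<in>paths_from x n. distinct p \<longrightarrow>
      2 ^ n * exp (- (t * path_length \<omega> p)) \<le> B"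
    using AE_self_avoiding_paths_long by blast
  obtain a where a: "0 < a" and short: "AE \<omega> in \<Omega>. \<exists>B\<ge>1. \<forall>n. \<forall>p\<in>paths_from x (Suc n).
      exp (a * (\<omega> {p ! n, p ! Suc n})\<^sup>2) * decay ^ Suc n \<le> B"
    using AE_last_edge_short by blast
  show ?thesis
    using AE_space long short AE_last_edge_pos[of x]
  proof (eventually_elim, intro allI impI)
    fix \<omega> \<sigma>
    assume \<omega>: "\<omega> \<in> space \<Omega>"
      and "\<exists>B\<ge>1. \<forall>n. \<forall>p\<in>paths_from x n. distinct p \<longrightarrow> 2 ^ n * exp (- (t * path_length \<omega> p)) \<le> B"
      and "\<exists>B\<ge>1. \<forall>n. \<forall>p\<in>paths_from x (Suc n).
        exp (a * (\<omega> {p ! n, p ! Suc n})\<^sup>2) * decay ^ Suc n \<le> B"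
      and pos: "\<forall>n. \<forall>p\<in>paths_from x (Suc n). 0 < \<omega> {p ! n, p ! Suc n}"
      and ray: "fpp_geodesic_ray V E \<omega> \<sigma> \<and> \<sigma> 0 = x"
    then obtain B B' where B: "1 \<le> B" "\<And>n p. p \<in> paths_from x n \<Longrightarrow> distinct p \<Longrightarrow>
        2 ^ n * exp (- (t * path_length \<omega> p)) \<le> B"
      and B': "1 \<le> B'" "\<And>n p. p \<in> paths_from x (Suc n) \<Longrightarrow>
        exp (a * (\<omega> {p ! n, p ! Suc n})\<^sup>2) * decay ^ Suc n \<le> B'"
      by blast
    have nonneg: "0 \<le> \<omega> e" if "e \<in> E" for e
      using \<omega> that by (rule weight_nonneg)
    have "inj \<sigma>"
      using nonneg pos ray by (intro ray_self_avoiding[of \<omega> x]) auto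
    define A where "A = 1 + (ln B' + ln (1 / decay)) / a"
    have A: "0 \<le> A"
      using a B'(1) decay by (simp add: A_def)
    have "real i \<le> (t * A + ln B) / ln 2 * (1 + graph_dist V E x (\<sigma> i))\<^sup>2" for i
    proof -
      define p where "p = map \<sigma> [0..<Suc i]"
      have p: "p \<in> paths_from x i" "distinct p" "last p = \<sigma> i" "hd p = x"
        and geod: "path_length \<omega> p = fpp_dist V E \<omega> x (\<sigma> i)"
        using ray \<open>inj \<sigma>\<close> by (auto simp: fpp_geodesic_ray_def fpp_geodesic_def p_def paths_from_def
          hd_map last_map distinct_map inj_on_def dest: injD simp del: upt_Suc)
      have "\<sigma> i \<in> V"
        using p(1,3) last_in_set[of p] by (auto simp: paths_from_def edge_path_def)
      then have upper: "path_length \<omega> p \<le> A * (1 + graph_dist V E x (\<sigma> i))\<^sup>2"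
        unfolding geod A_def using nonneg a B' x by (intro dist_le_quadratic) auto
      have "ln (2 ^ i * exp (- (t * path_length \<omega> p))) \<le> ln B"
        using B(2)[OF p(1,2)] B(1) by (intro ln_mono) auto
      then have "real i * ln 2 \<le> t * path_length \<omega> p + ln B"
        by (simp add: ln_mult ln_realpow)
      also have "\<dots> \<le> t * (A * (1 + graph_dist V E x (\<sigma> i))\<^sup>2) + ln B * (1 + graph_dist V E x (\<sigma> i))\<^sup>2"
      proof (intro add_mono)
        show "t * path_length \<omega> p \<le> t * (A * (1 + graph_dist V E x (\<sigma> i))\<^sup>2)"
          using upper t by simp
        have "1 \<le> (1 + graph_dist V E x (\<sigma> i))\<^sup>2"
          using dist_nonneg[OF x \<open>\<sigma> i \<in> V\<close>] by (intro one_le_power) simp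
        then show "ln B \<le> ln B * (1 + graph_dist V E x (\<sigma> i))\<^sup>2"
          using B(1) mult_left_mono[of 1 _ "ln B"] by simp
      qed
      finally show ?thesis
        by (simp add: field_simps)
    qed
    moreover have "0 \<le> (t * A + ln B) / ln 2"
      using t A B(1) by simp
    ultimately show "\<exists>B\<ge>0. \<forall>i. real i \<le> B * (1 + graph_dist V E x (\<sigma> i))\<^sup>2"
      by blast
  qed
qed

end


section \<open>Directions of geodesic rays\<close>

theorem theorem6p6:
  fixes G :: "('a, 'b) monoid_scheme" and S :: "'a set" and \<rho> :: "real measure" and x\<^sub>0 :: 'a
  assumes "hyperbolic_group G"
    and "finite_symmetric_generating_set G S"
    and "passage_time_law \<rho>"
    and "x\<^sub>0 \<in> carrier G"
  shows "AE \<omega> in passage_time_space (cayley_edges G S) \<rho>.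
           \<forall>\<sigma>. fpp_geodesic_ray (carrier G) (cayley_edges G S) \<omega> \<sigma> \<and> \<sigma> 0 = x\<^sub>0 \<longrightarrow>
             (\<exists>\<xi>\<in>gromov_boundary (carrier G) (cayley_dist G S) \<one>\<^bsub>G\<^esub>.
                has_direction (carrier G) (cayley_dist G S) \<one>\<^bsub>G\<^esub> \<sigma> \<xi>)"
proof -
  have "group G"
    using assms(1) by (simp add: hyperbolic_group_def)
  then interpret cayley_graph G S
    by (simp add: cayley_graph_def cayley_graph_axioms_def assms(2))
  obtain \<delta> where "hyperbolic_space (carrier G) (cayley_dist G S) \<delta>"
    using hyperbolic_group_word_metric assms(1,2) by blast
  then interpret word: hyperbolic_space "carrier G" "cayley_dist G S" \<delta> .
  interpret passage_times \<rho>
    by unfold_locales (rule assms(3))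
  interpret first_passage_percolation "carrier G" "cayley_edges G S" "card S" \<rho>
    by unfold_locales
  show ?thesis
    using AE_geodesic_rays_escape[OF assms(4)]
  proof (eventually_elim, intro allI impI)
    fix \<omega> \<sigma>
    assume "\<forall>\<sigma>. fpp_geodesic_ray (carrier G) (cayley_edges G S) \<omega> \<sigma> \<and> \<sigma> 0 = x\<^sub>0 \<longrightarrow>
        (\<exists>B\<ge>0. \<forall>i. real i \<le> B * (1 + graph_dist (carrier G) (cayley_edges G S) x\<^sub>0 (\<sigma> i))\<^sup>2)"
      and ray: "fpp_geodesic_ray (carrier G) (cayley_edges G S) \<omega> \<sigma> \<and> \<sigma> 0 = x\<^sub>0"
    then obtain B where B: "0 \<le> B" "\<And>i. real i \<le> B * (1 + cayley_dist G S x\<^sub>0 (\<sigma> i))\<^sup>2"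
      by (auto simp: cayley_dist_def)
    have "edge_path (carrier G) (cayley_edges G S) (map \<sigma> [i..<Suc (Suc i)])" for i
      using ray by (simp add: fpp_geodesic_ray_def fpp_geodesic_def del: upt_Suc)
    then have \<sigma>: "\<sigma> i \<in> carrier G" "{\<sigma> i, \<sigma> (Suc i)} \<in> cayley_edges G S" for i
      by (auto simp: edge_path_def)
    \<comment> \<open>Gromov products are taken at the unit, whereas the ray starts at \<open>x\<^sub>0\<close>: the distances to both
      differ by at most \<open>r\<close>.\<close>
    define r where "r = cayley_dist G S x\<^sub>0 \<one>\<^bsub>G\<^esub>"
    have r: "0 \<le> r"
      using word.dist_nonneg assms(4) by (simp add: r_def)
    have "gromov_equiv (cayley_dist G S) \<one>\<^bsub>G\<^esub> \<sigma> \<sigma>"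
    proof (rule word.converges_if_escapes[where L = 1 and B = "B * (1 + r)\<^sup>2"])
      show "cayley_dist G S (\<sigma> i) (\<sigma> (Suc i)) \<le> 1" for i
        unfolding cayley_dist_def using \<sigma> by (intro dist_adjacent)
      show "real i \<le> B * (1 + r)\<^sup>2 * (1 + cayley_dist G S (\<sigma> i) \<one>\<^bsub>G\<^esub>)\<^sup>2" for i
      proof -
        define s where "s = cayley_dist G S (\<sigma> i) \<one>\<^bsub>G\<^esub>"
        have s: "0 \<le> s"
          using word.dist_nonneg \<sigma> by (simp add: s_def)
        have "cayley_dist G S x\<^sub>0 (\<sigma> i) \<le> r + s"
          using word.dist_triangle[of x\<^sub>0 "\<one>\<^bsub>G\<^esub>" "\<sigma> i"] word.dist_sym[of "\<sigma> i" "\<one>\<^bsub>G\<^esub>"] \<sigma> assms(4)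
          by (simp add: r_def s_def)
        also have "1 + (r + s) \<le> (1 + r) * (1 + s)"
          using r s by (simp add: algebra_simps)
        finally have "(1 + cayley_dist G S x\<^sub>0 (\<sigma> i))\<^sup>2 \<le> ((1 + r) * (1 + s))\<^sup>2"
          using word.dist_nonneg[OF assms(4) \<sigma>(1)[of i]] by (intro power_mono) auto
        then have "B * (1 + cayley_dist G S x\<^sub>0 (\<sigma> i))\<^sup>2 \<le> B * ((1 + r) * (1 + s))\<^sup>2"
          using B(1) by (rule mult_left_mono)
        then show ?thesis
          using B(2)[of i] by (simp add: s_def power_mult_distrib mult.assoc)
      qed
    qed (use \<sigma> in auto)
    then have "\<sigma> \<in> converging_at_infinity (carrier G) (cayley_dist G S) \<one>\<^bsub>G\<^esub>"
      using \<sigma> by (auto simp: converging_at_infinity_def)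
    then show "\<exists>\<xi>\<in>gromov_boundary (carrier G) (cayley_dist G S) \<one>\<^bsub>G\<^esub>.
        has_direction (carrier G) (cayley_dist G S) \<one>\<^bsub>G\<^esub> \<sigma> \<xi>"
      by (intro word.has_direction_if_converges) auto
  qed
qed

end
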